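(* Let $\mu=\frac12$. The global minimizers of $\mathcal{G}_{1/2}$ over $\{u\in\mathcal{E}:M(u)=1\}$ are exactly, up to phase and space rotations, the functions $\varphi_0$, $\varphi_1$ and $\psi_b$ with $0\le b<+\infty$, where $$\varphi_0(z)=\frac{1}{\sqrt{\pi}}e^{-\frac{|z|^2}{2}},\qquad \varphi_1(z)=\frac{1}{\sqrt{\pi}}\,z\,e^{-\frac{|z|^2}{2}},$$ $$\psi_b(z)=\frac{e^{-\frac12\left(\frac{b}{1+b^2}\right)^2}}{\sqrt{\pi(1+b^2)}}\left(z-\frac{b(2+b^2)}{1+b^2}\right)e^{\frac{b}{1+b^2}z-\frac{|z|^2}{2}}.$$
   Context: $L$ denotes Lebesgue measure on $\mathbb{C}$. The Bargmann-Fock space is $\mathcal{E}=\{u(z)=e^{-|z|^2/2}f(z): f \text{ entire holomorphic on } \mathbb{C}\}\cap L^2(\mathbb{C})$. For $u\in\mathcal{E}$ set $\mathcal{H}(u)=\frac14\int_{\mathbb{C}}|u|^4\,dL$, $M(u)=\int_{\mathbb{C}}|u|^2\,dL$, $P(u)=\int_{\mathbb{C}}(|z|^2-1)|u(z)|^2\,dL(z)$ (possibly $+\infty$), and $\mathcal{G}_\mu(u)=8\pi\mathcal{H}(u)+\mu P(u)$ for $\mu>0$. A global minimizer is a $u\in\mathcal{E}$ with $M(u)=1$ and $\mathcal{G}_\mu(u)\le\mathcal{G}_\mu(v)$ for all $v\in\mathcal{E}$ with $M(v)=1$. Phase rotations are the maps $u(z)\mapsto e^{i\gamma}u(z)$,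 $\gamma\in\mathbb{R}$; space rotations are the maps $u(z)\mapsto u(e^{i\theta}z)$, $\theta\in\mathbb{R}$. *)

theory Defs
  imports "HOL-Complex_Analysis.Complex_Analysis"
begin

definition square_integrable :: "(complex \<Rightarrow> complex) set" where
  "square_integrable =
     {u. u \<in> borel_measurable lborel \<and> integrable lborel (\<lambda>z. (norm (u z))\<^sup>2)}"

text \<open>The elements of the Bargmann-Fock space are taken as honest (continuous) functions,
  not as classes modulo almost everywhere equality.\<close>

definition bargmann_fock :: "(complex \<Rightarrow> complex) set" where
  "bargmann_fock =
     {u. \<exists>f. f holomorphic_on UNIV \<and>
             u = (\<lambda>z. complex_of_real (exp (- (norm z)\<^sup>2 / 2)) * f z)}
     \<inter> square_integrable"

text \<open>Integral of a real function with value in the extended reals: integral of the positive part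
  minus integral of the negative part. It is meaningful when at least one of the two is finite;
  for the integrand of \<open>angular_P\<close> below the negative part is at most \<open>mass u\<close>.\<close>

definition ext_integral :: "(complex \<Rightarrow> real) \<Rightarrow> ereal" where
  "ext_integral g =
     enn2ereal (\<integral>\<^sup>+z. ennreal (g z) \<partial>lborel) - enn2ereal (\<integral>\<^sup>+z. ennreal (- g z) \<partial>lborel)"

definition hamiltonian :: "(complex \<Rightarrow> complex) \<Rightarrow> ereal" where
  "hamiltonian u = ereal (1/4) * ext_integral (\<lambda>z. (norm (u z)) ^ 4)"

definition mass :: "(complex \<Rightarrow> complex) \<Rightarrow> real" where
  "mass u = (\<integral>z. (norm (u z))\<^sup>2 \<partial>lborel)"

definition angular_P :: "(complex \<Rightarrow> complex) \<Rightarrow> ereal" where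
  "angular_P u = ext_integral (\<lambda>z. ((norm z)\<^sup>2 - 1) * (norm (u z))\<^sup>2)"

definition energy_G :: "real \<Rightarrow> (complex \<Rightarrow> complex) \<Rightarrow> ereal" where
  "energy_G \<mu> u = ereal (8 * pi) * hamiltonian u + ereal \<mu> * angular_P u"

definition global_minimizer :: "real \<Rightarrow> (complex \<Rightarrow> complex) \<Rightarrow> bool" where
  "global_minimizer \<mu> u \<longleftrightarrow>
     u \<in> bargmann_fock \<and> mass u = 1 \<and>
     (\<forall>v \<in> bargmann_fock. mass v = 1 \<longrightarrow> energy_G \<mu> u \<le> energy_G \<mu> v)"

definition phase_rotation :: "real \<Rightarrow> (complex \<Rightarrow> complex) \<Rightarrow> complex \<Rightarrow> complex" where
  "phase_rotation \<gamma> u = (\<lambda>z. exp (\<i> * of_real \<gamma>) * u z)"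

definition space_rotation :: "real \<Rightarrow> (complex \<Rightarrow> complex) \<Rightarrow> complex \<Rightarrow> complex" where
  "space_rotation \<theta> u = (\<lambda>z. u (exp (\<i> * of_real \<theta>) * z))"

definition phi0 :: "complex \<Rightarrow> complex" where
  "phi0 z = of_real (1 / sqrt pi) * exp (of_real (- (norm z)\<^sup>2 / 2))"

definition phi1 :: "complex \<Rightarrow> complex" where
  "phi1 z = of_real (1 / sqrt pi) * z * exp (of_real (- (norm z)\<^sup>2 / 2))"

definition psi :: "real \<Rightarrow> complex \<Rightarrow> complex" where
  "psi b z =
     of_real (exp (- (1/2) * (b / (1 + b\<^sup>2))\<^sup>2) / sqrt (pi * (1 + b\<^sup>2)))
     * (z - of_real (b * (2 + b\<^sup>2) / (1 + b\<^sup>2)))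
     * exp (of_real (b / (1 + b\<^sup>2)) * z - of_real ((norm z)\<^sup>2 / 2))"

end

theory Submission
  imports Defs "HOL-Probability.Distributions"
begin

text \<open>Write \<open>u = e^(-|z|^2/2) f\<close> with \<open>M(u) = 1\<close> and rotate the coordinates of \<open>u(z1) u(z2)\<close> by
  \<open>z1 = (Z + w) / sqrt 2\<close>, \<open>z2 = (Z - w) / sqrt 2\<close>. With
  \<open>F Z w = f z1 f z2\<close> and \<open>Q = \<integral> z |u|^2\<close>, the quantity \<open>2 (G(u) - 1) - |Q|^2\<close> is the integral over \<open>Z\<close>
  of \<open>e^(-|Z|^2)\<close> times
  \<open>2 pi |F Z 0|^2 + \<integral> (|w|^2 - 3) |F Z w|^2 e^(-|w|^2) dw = pi \<Sum>_(n\<ge>3) n! (n - 2) |c_n|^2\<close>,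
  where the \<open>c_n\<close> are the Taylor coefficients of the even function \<open>w \<mapsto> F Z w\<close>. Hence \<open>G \<ge> 1\<close>, and equality
  forces \<open>Q = 0\<close> and \<open>f (Z + w) f (Z - w) = f(Z)^2 + w^2 B(Z)\<close>. Inspecting the zeros of \<open>f\<close>, this
  functional equation is only solved by \<open>(\<alpha> + \<beta> z) e^(a z)\<close>, and \<open>Q = 0\<close> then determines \<open>a\<close>.\<close>

subsection \<open>Lebesgue measure on the complex plane\<close>

text \<open>The quartic integral becomes quadratic in the product state, because
  \<open>K Z 0\<close> is the square of \<open>p\<close> at \<open>Z / sqrt 2\<close>. In the
  relative variable, a component \<open>w^n\<close> of unit mass contributes
  \<open>mu * (n + 1)\<close> through the second moment, and 1 more if \<open>n = 0\<close>, through
  the value at \<open>w = 0\<close>. As \<open>F Z\<close> is even, the lowest levels are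
  \<open>n = 0\<close> with \<open>mu + 1\<close> and \<open>n = 2\<close> with
  \<open>3 * mu\<close>. They tie exactly at \<open>mu = 1/2\<close>: this explains the constant 3
  (twice the common level) and why a whole family of minimizers appears, whose product states mix
  both levels. The analytic obstacle is finiteness: the second moment may be infinite, integrability
  of \<open>|u|^4\<close> is not given, and a slice \<open>K Z\<close> is only known to be
  integrable for almost every \<open>Z\<close>. An infinite second moment means infinite energy; the
  quartic integral is bounded because \<open>pi * K Z 0\<close> is at most the mass of its slice;
  and the equality case passes from almost every \<open>Z\<close> to every \<open>Z\<close> by
  continuity.\<close>

lemma measurable_Complex [measurable]:
  assumes [measurable]: "f \<in> borel_measurable M" "g \<in> borel_measurable M"
  shows "(\<lambda>x. Complex (f x) (g x)) \<in> borel_measurable M"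
  unfolding Complex_eq by measurable

text \<open>Opens the way to Fubini in real and imaginary part: both measures give a box the product
  of its side lengths, which characterizes \<open>lborel\<close>.\<close>

lemma distr_lborel_Complex:
  "distr (lborel :: (real \<times> real) measure) borel (\<lambda>p. Complex (fst p) (snd p)) = lborel"
proof (rule lborel_eqI[symmetric])
  fix l u :: complex
  assume le: "\<And>b. b \<in> Basis \<Longrightarrow> l \<bullet> b \<le> u \<bullet> b"
  have le': "Re l \<le> Re u" "Im l \<le> Im u"
    using le[of 1] le[of \<i>] by (auto simp: Basis_complex_def)
  have m: "(\<lambda>p. Complex (fst p) (snd p)) \<in> borel_measurable (lborel :: (real \<times> real) measure)"
    by (simp add: borel_prod[symmetric])
  have v: "(\<lambda>p. Complex (fst p) (snd p)) -` box l u = box (Re l) (Re u) \<times> box (Im l) (Im u)"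
    by (auto simp: box_def Basis_complex_def)
  have "emeasure (distr (lborel :: (real \<times> real) measure) borel (\<lambda>p. Complex (fst p) (snd p))) (box l u)
      = emeasure (lborel \<Otimes>\<^sub>M lborel) (box (Re l) (Re u) \<times> box (Im l) (Im u))"
    by (subst emeasure_distr[OF m]) (simp_all add: v lborel_prod)
  also have "\<dots> = ennreal (Re u - Re l) * ennreal (Im u - Im l)"
    using le' by (subst lborel.emeasure_pair_measure_Times) auto
  also have "\<dots> = ennreal (\<Prod>b\<in>Basis. (u - l) \<bullet> b)"
    using le' by (simp add: Basis_complex_def ennreal_mult)
  finally show "emeasure (distr (lborel :: (real \<times> real) measure) borel (\<lambda>p. Complex (fst p) (snd p))) (box l u)
      = ennreal (\<Prod>b\<in>Basis. (u - l) \<bullet> b)" .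
qed simp

lemma nn_integral_Complex:
  assumes [measurable]: "f \<in> borel_measurable borel"
  shows "(\<integral>\<^sup>+z. f z \<partial>lborel) = (\<integral>\<^sup>+x. \<integral>\<^sup>+y. f (Complex x y) \<partial>lborel \<partial>lborel)"
proof -
  have "(\<integral>\<^sup>+z. f z \<partial>lborel)
      = (\<integral>\<^sup>+z. f z \<partial>distr (lborel \<Otimes>\<^sub>M lborel) borel (\<lambda>p. Complex (fst p) (snd p)))"
    by (simp add: distr_lborel_Complex lborel_prod)
  also have "\<dots> = (\<integral>\<^sup>+p. f (Complex (fst p) (snd p)) \<partial>(lborel \<Otimes>\<^sub>M lborel))"
    by (rule nn_integral_distr) simp_all
  also have "\<dots> = (\<integral>\<^sup>+x. \<integral>\<^sup>+y. f (Complex x y) \<partial>lborel \<partial>lborel)"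
    by (subst lborel.nn_integral_fst[symmetric]) simp_all
  finally show ?thesis .
qed

text \<open>The rotation is split into two one-dimensional substitutions with Fubini between them:
  \<open>a * x - b * y\<close> becomes the new \<open>x\<close> for fixed \<open>y\<close>, then
  \<open>(b * x + y) / a\<close> becomes the new \<open>y\<close> for fixed \<open>x\<close>. The
  factors \<open>1 / \<bar>a\<bar>\<close> and \<open>\<bar>a\<bar>\<close> cancel; the division is
  the reason for \<open>Re \<omega> \<noteq> 0\<close>.\<close>

lemma nn_integral_rotate:
  fixes \<omega> :: complex
  assumes f [measurable]: "f \<in> borel_measurable borel" and w: "cmod \<omega> = 1" and r: "Re \<omega> \<noteq> 0"
  shows "(\<integral>\<^sup>+z. f (\<omega> * z) \<partial>lborel) = (\<integral>\<^sup>+z. f z \<partial>lborel)"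
proof -
  define a b where "a = Re \<omega>" and "b = Im \<omega>"
  have ab: "a\<^sup>2 + b\<^sup>2 = 1" "a \<noteq> 0"
    using w r by (auto simp: a_def b_def cmod_def)
  have ab': "a * a + b * b = 1" using ab by (simp add: power2_eq_square)
  have mult: "\<omega> * Complex x y = Complex (a * x - b * y) (b * x + a * y)" for x y
    by (simp add: complex_eq_iff a_def b_def)
  have "(\<integral>\<^sup>+z. f (\<omega> * z) \<partial>lborel)
      = (\<integral>\<^sup>+x. \<integral>\<^sup>+y. f (Complex (a * x - b * y) (b * x + a * y)) \<partial>lborel \<partial>lborel)"
    by (subst nn_integral_Complex) (simp_all add: mult)
  also have "\<dots> = (\<integral>\<^sup>+y. \<integral>\<^sup>+x. f (Complex (a * x - b * y) (b * x + a * y)) \<partial>lborel \<partial>lborel)"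
    by (rule lborel_pair.Fubini') simp
  also have "\<dots> = (\<integral>\<^sup>+y. ennreal \<bar>1 / a\<bar> * (\<integral>\<^sup>+x. f (Complex x ((b * x + y) / a)) \<partial>lborel) \<partial>lborel)"
  proof (rule nn_integral_cong)
    fix y
    have "(\<integral>\<^sup>+x. f (Complex (a * x - b * y) (b * x + a * y)) \<partial>lborel)
        = ennreal \<bar>1 / a\<bar> * (\<integral>\<^sup>+x. f (Complex (a * (b * y / a + 1 / a * x) - b * y)
             (b * (b * y / a + 1 / a * x) + a * y)) \<partial>lborel)"
      by (rule nn_integral_real_affine) (use ab in simp_all)
    also have "(\<lambda>x. Complex (a * (b * y / a + 1 / a * x) - b * y) (b * (b * y / a + 1 / a * x) + a * y))
        = (\<lambda>x. Complex x ((b * x + y) / a))"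
    proof
      fix x
      have "b * (b * y / a + 1 / a * x) + a * y = (b * x + (a * a + b * b) * y) / a"
        using ab(2) by (simp add: field_simps)
      then show "Complex (a * (b * y / a + 1 / a * x) - b * y) (b * (b * y / a + 1 / a * x) + a * y)
          = Complex x ((b * x + y) / a)"
        using ab(2) ab' by (simp add: field_simps)
    qed
    finally show "(\<integral>\<^sup>+x. f (Complex (a * x - b * y) (b * x + a * y)) \<partial>lborel)
        = ennreal \<bar>1 / a\<bar> * (\<integral>\<^sup>+x. f (Complex x ((b * x + y) / a)) \<partial>lborel)"
      by (simp add: fun_eq_iff)
  qed
  also have "\<dots> = ennreal \<bar>1 / a\<bar> * (\<integral>\<^sup>+y. (\<integral>\<^sup>+x. f (Complex x ((b * x + y) / a)) \<partial>lborel) \<partial>lborel)"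
    by (rule nn_integral_cmult) simp
  also have "(\<integral>\<^sup>+y. (\<integral>\<^sup>+x. f (Complex x ((b * x + y) / a)) \<partial>lborel) \<partial>lborel)
      = (\<integral>\<^sup>+x. (\<integral>\<^sup>+y. f (Complex x ((b * x + y) / a)) \<partial>lborel) \<partial>lborel)"
    by (rule lborel_pair.Fubini') simp
  also have "\<dots> = (\<integral>\<^sup>+x. ennreal \<bar>a\<bar> * (\<integral>\<^sup>+y. f (Complex x y) \<partial>lborel) \<partial>lborel)"
  proof (rule nn_integral_cong)
    fix x
    show "(\<integral>\<^sup>+y. f (Complex x ((b * x + y) / a)) \<partial>lborel)
        = ennreal \<bar>a\<bar> * (\<integral>\<^sup>+y. f (Complex x y) \<partial>lborel)"
      using ab(2) by (subst nn_integral_real_affine[where c = a and t = "- b * x"]) simp_all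
  qed
  also have "\<dots> = ennreal \<bar>a\<bar> * (\<integral>\<^sup>+x. (\<integral>\<^sup>+y. f (Complex x y) \<partial>lborel) \<partial>lborel)"
    by (rule nn_integral_cmult) simp
  also have "ennreal \<bar>1 / a\<bar> * (ennreal \<bar>a\<bar> * (\<integral>\<^sup>+x. (\<integral>\<^sup>+y. f (Complex x y) \<partial>lborel) \<partial>lborel))
      = (\<integral>\<^sup>+z. f z \<partial>lborel)"
    using ab(2) by (subst nn_integral_Complex)
      (simp_all add: mult.assoc[symmetric] ennreal_mult[symmetric] abs_mult[symmetric])
  finally show ?thesis .
qed

lemma distr_lborel_rotate:
  fixes \<omega> :: complex
  assumes "cmod \<omega> = 1" and "Re \<omega> \<noteq> 0"
  shows "distr lborel borel (\<lambda>z. \<omega> * z) = lborel"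
proof (rule measure_eqI)
  fix A assume "A \<in> sets (distr lborel borel (\<lambda>z. \<omega> * z))"
  then have A [measurable]: "A \<in> sets borel" by simp
  show "emeasure (distr lborel borel (\<lambda>z. \<omega> * z)) A = emeasure lborel A"
    using nn_integral_rotate[of "indicator A" \<omega>] assms
    by (simp add: nn_integral_distr flip: nn_integral_indicator)
qed simp

text \<open>A disc of squared radius \<open>t\<close> has area \<open>pi * t\<close>, so
  \<open>|z|^2\<close> has constant density \<open>pi\<close> on the half line. This takes the role
  of polar coordinates for radial integrands.\<close>

lemma distr_lborel_norm_sq:
  "distr (lborel :: complex measure) borel (\<lambda>z. (cmod z)\<^sup>2)
    = density lborel (\<lambda>s. ennreal pi * indicator {0..} s)"
proof (rule measure_eqI_generator_eq[where E = "range atMost" and A = "\<lambda>i. {..real i}" and \<Omega> = UNIV])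
  show "Int_stable (range (atMost :: real \<Rightarrow> _))"
    by (auto simp: Int_stable_def)
  show "sets (distr (lborel :: complex measure) borel (\<lambda>z. (cmod z)\<^sup>2)) = sigma_sets UNIV (range atMost)"
    by (simp add: borel_eq_atMost)
  show "sets (density lborel (\<lambda>s::real. ennreal pi * indicator {0..} s)) = sigma_sets UNIV (range atMost)"
    by (simp add: borel_eq_atMost)
  have L: "emeasure (distr (lborel :: complex measure) borel (\<lambda>z. (cmod z)\<^sup>2)) {..t}
      = ennreal (if t < 0 then 0 else pi * t)" for t
  proof -
    have v: "(\<lambda>z. (cmod z)\<^sup>2) -` {..t} = (if t < 0 then {} else cball (0::complex) (sqrt t))"
    proof (cases "t < 0")
      case True
      then have "\<not> (cmod z)\<^sup>2 \<le> t" for z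
        using zero_le_power2[of "cmod z"] by linarith
      with True show ?thesis by auto
    next
      case False
      then have "(cmod z)\<^sup>2 \<le> t \<longleftrightarrow> cmod z \<le> sqrt t" for z
        using real_sqrt_le_iff[of "(cmod z)\<^sup>2" t] by simp
      with False show ?thesis by auto
    qed
    show ?thesis
      by (simp add: emeasure_distr v emeasure_cball unit_ball_vol_2)
  qed
  have R: "emeasure (density lborel (\<lambda>s. ennreal pi * indicator {0..} s)) {..t}
      = ennreal (if t < 0 then 0 else pi * t)" for t
  proof -
    have "emeasure (density lborel (\<lambda>s. ennreal pi * indicator {0..} s)) {..t}
        = (\<integral>\<^sup>+s. ennreal pi * indicator {0..t} s \<partial>lborel)"
      by (subst emeasure_density) (auto intro!: nn_integral_cong split: split_indicator)
    also have "\<dots> = ennreal pi * emeasure lborel {0..t}"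
      by (subst nn_integral_cmult) simp_all
    also have "\<dots> = ennreal (if t < 0 then 0 else pi * t)"
      by (auto simp: ennreal_mult)
    finally show ?thesis .
  qed
  show "emeasure (distr (lborel :: complex measure) borel (\<lambda>z. (cmod z)\<^sup>2)) X
      = emeasure (density lborel (\<lambda>s. ennreal pi * indicator {0..} s)) X"
    if "X \<in> range atMost" for X
    using that by (auto simp: L R)
  show "(\<Union>i. {..real i}) = UNIV"
    using real_arch_simple by auto
  show "emeasure (distr (lborel :: complex measure) borel (\<lambda>z. (cmod z)\<^sup>2)) {..real i} \<noteq> \<infinity>" for i
    by (simp add: L)
qed auto

text \<open>In the variable \<open>s = |z|^2\<close> this is \<open>pi\<close> times a Gamma
  integral.\<close>

lemma nn_integral_gaussian_moment:
  "(\<integral>\<^sup>+z. ennreal (cmod z ^ (2 * n) * exp (- (cmod z)\<^sup>2)) \<partial>lborel) = ennreal (pi * fact n)"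
proof -
  have "(\<integral>\<^sup>+z. ennreal (cmod z ^ (2 * n) * exp (- (cmod z)\<^sup>2)) \<partial>lborel)
      = (\<integral>\<^sup>+s. ennreal (s ^ n * exp (- s)) \<partial>distr lborel borel (\<lambda>z::complex. (cmod z)\<^sup>2))"
    by (subst nn_integral_distr) (simp_all add: power_mult)
  also have "\<dots> = (\<integral>\<^sup>+s. ennreal pi * (ennreal (s ^ n * exp (- s)) * indicator {0..} s) \<partial>lborel)"
    by (simp add: distr_lborel_norm_sq nn_integral_density mult_ac)
  also have "\<dots> = ennreal pi * ennreal (fact n)"
    by (subst nn_integral_cmult) (simp_all add: nn_intergal_power_times_exp_Ici)
  finally show ?thesis by (simp add: ennreal_mult)
qed

lemma nn_integral_complex_affine:
  fixes f :: "complex \<Rightarrow> ennreal"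
  assumes [measurable]: "f \<in> borel_measurable borel" and c: "c \<noteq> 0"
  shows "(\<integral>\<^sup>+z. f z \<partial>lborel) = ennreal (c\<^sup>2) * (\<integral>\<^sup>+z. f (t + of_real c * z) \<partial>lborel)"
  by (subst lborel_affine[OF c, of t])
    (simp add: nn_integral_density nn_integral_distr nn_integral_cmult scaleR_conv_of_real)

text \<open>The map is orthogonal. Its Jacobian is obtained from two substitutions in one complex
  variable each: \<open>z2 = z1 - sqrt 2 * w\<close> contributes the factor 2, then
  \<open>z1 = (Z + w) / sqrt 2\<close> for fixed \<open>w\<close> contributes
  \<open>1 / 2\<close>.\<close>

lemma distr_lborel_half_turn:
  "distr (lborel \<Otimes>\<^sub>M lborel) (lborel \<Otimes>\<^sub>M lborel)
     (\<lambda>(Z, w). ((Z + w) / of_real (sqrt 2), (Z - w) / of_real (sqrt 2)))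
    = (lborel \<Otimes>\<^sub>M lborel :: (complex \<times> complex) measure)"
    (is "distr _ _ ?T = _")
proof (rule measure_eqI)
  fix A assume "A \<in> sets (distr (lborel \<Otimes>\<^sub>M lborel) (lborel \<Otimes>\<^sub>M lborel) ?T)"
  then have A [measurable]: "A \<in> sets (lborel \<Otimes>\<^sub>M lborel)" by simp
  define G :: "complex \<times> complex \<Rightarrow> ennreal" where "G = indicator A"
  have G [measurable]: "G \<in> borel_measurable (borel \<Otimes>\<^sub>M borel)"
    using A unfolding G_def by (simp add: measurable_def cong: sets_pair_measure_cong)
  define s where "s = complex_of_real (sqrt 2)"
  have s: "s * s = 2" "s \<noteq> 0" by (auto simp: s_def simp flip: of_real_mult)
  have "emeasure (lborel \<Otimes>\<^sub>M lborel) A = (\<integral>\<^sup>+x. G x \<partial>(lborel \<Otimes>\<^sub>M lborel))"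
    unfolding G_def by (rule nn_integral_indicator[symmetric]) (rule A)
  also have "\<dots> = (\<integral>\<^sup>+z1. \<integral>\<^sup>+z2. G (z1, z2) \<partial>lborel \<partial>lborel)"
    by (rule lborel.nn_integral_fst[symmetric]) simp
  also have "\<dots> = (\<integral>\<^sup>+z1. ennreal 2 * (\<integral>\<^sup>+w. G (z1, z1 - s * w) \<partial>lborel) \<partial>lborel)"
  proof (rule nn_integral_cong)
    fix z1 :: complex
    show "(\<integral>\<^sup>+z2. G (z1, z2) \<partial>lborel) = ennreal 2 * (\<integral>\<^sup>+w. G (z1, z1 - s * w) \<partial>lborel)"
      by (subst nn_integral_complex_affine[where c = "- sqrt 2" and t = z1]) (simp_all add: s_def)
  qed
  also have "\<dots> = ennreal 2 * (\<integral>\<^sup>+z1. \<integral>\<^sup>+w. G (z1, z1 - s * w) \<partial>lborel \<partial>lborel)"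
    by (rule nn_integral_cmult) simp
  also have "(\<integral>\<^sup>+z1. \<integral>\<^sup>+w. G (z1, z1 - s * w) \<partial>lborel \<partial>lborel)
      = (\<integral>\<^sup>+w. \<integral>\<^sup>+z1. G (z1, z1 - s * w) \<partial>lborel \<partial>lborel)"
    by (rule lborel_pair.Fubini') simp
  also have "\<dots> = (\<integral>\<^sup>+w. ennreal (1 / 2) * (\<integral>\<^sup>+Z. G ((Z + w) / s, (Z - w) / s) \<partial>lborel) \<partial>lborel)"
  proof (rule nn_integral_cong)
    fix w :: complex
    have "w / s + of_real (1 / sqrt 2) * Z = (Z + w) / s"
      "w / s + of_real (1 / sqrt 2) * Z - s * w = (Z - w) / s" for Z
      using s by (simp_all add: s_def[symmetric] field_simps)
    then show "(\<integral>\<^sup>+z1. G (z1, z1 - s * w) \<partial>lborel)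
        = ennreal (1 / 2) * (\<integral>\<^sup>+Z. G ((Z + w) / s, (Z - w) / s) \<partial>lborel)"
      by (subst nn_integral_complex_affine[where c = "1 / sqrt 2" and t = "w / s"])
        (simp_all add: power_divide)
  qed
  also have "\<dots> = ennreal (1 / 2) * (\<integral>\<^sup>+w. \<integral>\<^sup>+Z. G ((Z + w) / s, (Z - w) / s) \<partial>lborel \<partial>lborel)"
    by (rule nn_integral_cmult) simp
  also have "(\<integral>\<^sup>+w. \<integral>\<^sup>+Z. G ((Z + w) / s, (Z - w) / s) \<partial>lborel \<partial>lborel)
      = (\<integral>\<^sup>+Z. \<integral>\<^sup>+w. G ((Z + w) / s, (Z - w) / s) \<partial>lborel \<partial>lborel)"
    by (rule lborel_pair.Fubini') simp
  also have "\<dots> = (\<integral>\<^sup>+x. G (?T x) \<partial>(lborel \<Otimes>\<^sub>M lborel))"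
    by (subst lborel.nn_integral_fst[symmetric]) (simp_all add: s_def split_beta')
  also have "\<dots> = (\<integral>\<^sup>+x. G x \<partial>distr (lborel \<Otimes>\<^sub>M lborel) (lborel \<Otimes>\<^sub>M lborel) ?T)"
    by (rule nn_integral_distr[symmetric]) simp_all
  also have "\<dots> = emeasure (distr (lborel \<Otimes>\<^sub>M lborel) (lborel \<Otimes>\<^sub>M lborel) ?T) A"
    unfolding G_def by (rule nn_integral_indicator) (use A in \<open>simp only: sets_distr\<close>)
  also have "ennreal 2 * (ennreal (1 / 2) * X) = X" for X
  proof -
    have "ennreal 2 * ennreal (1 / 2) = ennreal (2 * (1 / 2))"
      by (rule ennreal_mult[symmetric]) auto
    then show ?thesis by (simp only: mult.assoc[symmetric]) simp
  qed
  finally show "emeasure (distr (lborel \<Otimes>\<^sub>M lborel) (lborel \<Otimes>\<^sub>M lborel) ?T) A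
      = emeasure (lborel \<Otimes>\<^sub>M lborel) A" by simp
qed simp

subsection \<open>Power series in Gaussian spaces\<close>

lemma borel_measurable_cnj [measurable]: "cnj \<in> borel_measurable borel"
  by (intro borel_measurable_continuous_onI continuous_intros)

text \<open>A suitable rotation preserves the measure and the radial weight but multiplies the
  monomial by \<open>cis 1\<close>, so the integral \<open>I\<close> satisfies
  \<open>I = cis 1 * I\<close> with \<open>cis 1 \<noteq> 1\<close>.\<close>

lemma integral_monomials_orthogonal:
  fixes \<phi> :: "real \<Rightarrow> real"
  assumes [measurable]: "\<phi> \<in> borel_measurable borel" and nm: "n \<noteq> m"
  shows "(\<integral>z. z ^ n * cnj z ^ m * of_real (\<phi> (cmod z)) \<partial>lborel) = 0"
proof -
  \<comment> \<open>This angle makes the rotation factor \<open>cis ((n - m) * t)\<close> equal to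
    \<open>cis 1\<close>, and \<open>\<bar>t\<bar> \<le> 1 < pi / 2\<close> keeps the real part of
    \<open>\<omega>\<close> nonzero, as rotation invariance requires.\<close>
  define t where "t = 1 / (real n - real m)"
  define \<omega> where "\<omega> = cis t"
  have d: "\<bar>real n - real m\<bar> \<ge> 1" using nm by linarith
  have "\<bar>t\<bar> \<le> 1" using d by (simp add: t_def divide_simps)
  then have "- (pi / 2) < t" "t < pi / 2" using pi_gt3 by auto
  then have "cos t > 0" by (rule cos_gt_zero_pi)
  then have w: "cmod \<omega> = 1" "Re \<omega> \<noteq> 0" by (auto simp: \<omega>_def)
  have cnj: "cnj z = cis (- t)" if "z = \<omega>" for z using that by (simp add: \<omega>_def cis_cnj)
  have "\<omega> ^ n * cnj \<omega> ^ m = cis (real n * t + real m * (- t))"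
    by (simp add: cnj[OF refl] Complex.DeMoivre cis_mult) (simp add: \<omega>_def Complex.DeMoivre cis_mult)
  also have "real n * t + real m * (- t) = (real n - real m) * t"
    by (simp add: algebra_simps)
  also have "\<dots> = 1" using d by (auto simp: t_def)
  finally have e: "\<omega> ^ n * cnj \<omega> ^ m = cis 1" .
  have "cis 1 \<noteq> 1"
    using sin_gt_zero[of 1] pi_gt3 by (auto simp: complex_eq_iff)
  define I where "I = (\<integral>z. z ^ n * cnj z ^ m * of_real (\<phi> (cmod z)) \<partial>lborel)"
  have "I = (\<integral>z. z ^ n * cnj z ^ m * of_real (\<phi> (cmod z)) \<partial>distr lborel borel (\<lambda>z. \<omega> * z))"
    by (simp add: distr_lborel_rotate[OF w] I_def)
  also have "\<dots> = (\<integral>z. (\<omega> * z) ^ n * cnj (\<omega> * z) ^ m * of_real (\<phi> (cmod (\<omega> * z))) \<partial>lborel)"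
    by (rule integral_distr) simp_all
  also have "\<dots> = (\<integral>z. cis 1 * (z ^ n * cnj z ^ m * of_real (\<phi> (cmod z))) \<partial>lborel)"
    by (simp add: e[symmetric] norm_mult w power_mult_distrib mult_ac)
  also have "\<dots> = cis 1 * I" by (simp add: I_def)
  finally have "(1 - cis 1) * I = 0" by (simp add: algebra_simps)
  with \<open>cis 1 \<noteq> 1\<close> show ?thesis by (simp add: I_def)
qed

text \<open>Parseval on a disc, where continuous integrands are integrable: expand the square of a
  partial sum, drop the mixed terms by orthogonality, and pass to the limit by dominated
  convergence.\<close>

lemma power_series_mean_square_disc:
  fixes \<phi> :: "real \<Rightarrow> real" and c :: "nat \<Rightarrow> complex"
  assumes cont: "continuous_on UNIV \<phi>"
    and g: "\<And>z. (\<lambda>n. c n * z ^ n) sums g z"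
  shows "(\<lambda>n. (cmod (c n))\<^sup>2 * (\<integral>z. indicator (cball 0 R) z * (cmod z ^ (2 * n) * \<phi> (cmod z)) \<partial>lborel))
      sums (\<integral>z. indicator (cball 0 R) z * ((cmod (g z))\<^sup>2 * \<phi> (cmod z)) \<partial>lborel)"
proof -
  have int: "integrable lborel (\<lambda>z. indicator (cball 0 R) z * h z)"
    if "continuous_on UNIV h" for h :: "complex \<Rightarrow> real"
    using borel_integrable_compact[of "cball 0 R" h] continuous_on_subset[OF that] by auto
  have cint: "integrable lborel (\<lambda>z. h z * of_real (indicator (cball 0 R) z * \<phi> (cmod z)))"
    if "continuous_on UNIV h" for h :: "complex \<Rightarrow> complex"
  proof -
    have "continuous_on UNIV (\<lambda>z. h z * of_real (\<phi> (cmod z)))"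
      by (intro continuous_intros that continuous_on_compose2[OF cont]) auto
    from borel_integrable_compact[of "cball 0 R", OF _ continuous_on_subset[OF this]]
    show ?thesis by (simp add: scaleR_conv_of_real mult_ac)
  qed
  have phim [measurable]: "\<phi> \<in> borel_measurable borel"
    using cont by (rule borel_measurable_continuous_onI)
  have phic: "continuous_on UNIV (\<lambda>z::complex. \<phi> (cmod z))"
    by (intro continuous_on_compose2[OF cont] continuous_intros) auto
  define s where "s N z = (\<Sum>n<N. c n * z ^ n)" for N z
  have s_cont: "continuous_on UNIV (s N)" for N
    unfolding s_def by (intro continuous_intros)
  have [measurable]: "s N \<in> borel_measurable borel" for N
    using s_cont by (rule borel_measurable_continuous_onI)
  have s_lim: "(\<lambda>N. s N z) \<longlonglongrightarrow> g z" for z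
    using g[of z] by (simp add: sums_def s_def)
  have [measurable]: "g \<in> borel_measurable borel"
    by (rule borel_measurable_LIMSEQ_metric[OF _ s_lim]) simp
  define w where "w z = indicator (cball 0 R) z * \<phi> (cmod z)" for z :: complex
  \<comment> \<open>The cut-off weight as a function of \<open>cmod z\<close> alone, the form in
    which orthogonality of monomials applies.\<close>
  define \<psi> where "\<psi> r = indicator {..R} r * \<phi> r" for r :: real
  have [measurable]: "\<psi> \<in> borel_measurable borel" unfolding \<psi>_def by measurable
  have w\<psi>: "w z = \<psi> (cmod z)" for z
    by (simp add: w_def \<psi>_def indicator_def)
  have [measurable]: "w \<in> borel_measurable borel" unfolding w\<psi>[abs_def] by measurable
  have part: "(\<integral>z. (cmod (s N z))\<^sup>2 * w z \<partial>lborel)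
      = (\<Sum>n<N. (cmod (c n))\<^sup>2 * (\<integral>z. cmod z ^ (2 * n) * w z \<partial>lborel))" for N
  proof -
    have term_int: "integrable lborel (\<lambda>z. z ^ n * cnj z ^ m * of_real (w z))" for n m
      unfolding w_def by (intro cint continuous_intros)
    have diag: "(\<integral>z. z ^ n * cnj z ^ n * of_real (w z) \<partial>lborel)
        = of_real (\<integral>z. cmod z ^ (2 * n) * w z \<partial>lborel)" for n
    proof -
      have "z ^ n * cnj z ^ n * of_real (w z) = of_real (cmod z ^ (2 * n) * w z)" for z
        by (simp add: power_mult power_mult_distrib[symmetric] flip: complex_norm_square)
      then show ?thesis by (simp only: integral_complex_of_real)
    qed
    have "complex_of_real (\<integral>z. (cmod (s N z))\<^sup>2 * w z \<partial>lborel)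
        = (\<integral>z. of_real ((cmod (s N z))\<^sup>2 * w z) \<partial>lborel)"
      by (simp only: integral_complex_of_real)
    also have "\<dots> = (\<integral>z. (\<Sum>n<N. \<Sum>m<N. (c n * cnj (c m)) * (z ^ n * cnj z ^ m * of_real (w z))) \<partial>lborel)"
    proof (rule Bochner_Integration.integral_cong[OF refl])
      fix z
      have "complex_of_real ((cmod (s N z))\<^sup>2 * w z) = s N z * cnj (s N z) * of_real (w z)"
        by (simp flip: complex_norm_square)
      also have "s N z * cnj (s N z) = (\<Sum>n<N. \<Sum>m<N. (c n * z ^ n) * cnj (c m * z ^ m))"
        by (simp only: s_def cnj_sum sum_product)
      also have "\<dots> * of_real (w z) = (\<Sum>n<N. \<Sum>m<N. (c n * z ^ n) * cnj (c m * z ^ m) * of_real (w z))"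
        by (simp only: sum_distrib_right)
      also have "\<dots> = (\<Sum>n<N. \<Sum>m<N. (c n * cnj (c m)) * (z ^ n * cnj z ^ m * of_real (w z)))"
        by (intro sum.cong refl) simp
      finally show "complex_of_real ((cmod (s N z))\<^sup>2 * w z)
        = (\<Sum>n<N. \<Sum>m<N. (c n * cnj (c m)) * (z ^ n * cnj z ^ m * of_real (w z)))" .
    qed
    also have "\<dots> = (\<Sum>n<N. \<Sum>m<N. (c n * cnj (c m)) * (\<integral>z. z ^ n * cnj z ^ m * of_real (w z) \<partial>lborel))"
      by (subst Bochner_Integration.integral_sum | intro Bochner_Integration.integrable_sum integrable_mult_right term_int sum.cong refl
          Bochner_Integration.integral_sum)+ (simp add: term_int)
    also have "\<dots> = (\<Sum>n<N. \<Sum>m<N. if m = n then of_real ((cmod (c n))\<^sup>2 * (\<integral>z. cmod z ^ (2 * n) * w z \<partial>lborel)) else 0)"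
    proof (intro sum.cong refl)
      fix n m
      show "(c n * cnj (c m)) * (\<integral>z. z ^ n * cnj z ^ m * of_real (w z) \<partial>lborel)
        = (if m = n then of_real ((cmod (c n))\<^sup>2 * (\<integral>z. cmod z ^ (2 * n) * w z \<partial>lborel)) else 0)"
      proof (cases "m = n")
        case True
        then show ?thesis by (simp add: diag complex_norm_square del: of_real_power)
      next
        case False
        then show ?thesis
          using integral_monomials_orthogonal[of \<psi> n m] by (simp add: w\<psi>)
      qed
    qed
    also have "\<dots> = of_real (\<Sum>n<N. (cmod (c n))\<^sup>2 * (\<integral>z. cmod z ^ (2 * n) * w z \<partial>lborel))"
      by (simp add: sum.delta)
    finally show ?thesis by (simp only: of_real_eq_iff)
  qed
  \<comment> \<open>A bound for all partial sums on the disc; \<open>\<bar>R\<bar>\<close> keeps its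
    terms nonnegative also when \<open>R < 0\<close> and the disc is empty.\<close>
  define C where "C = (\<Sum>n. cmod (c n) * \<bar>R\<bar> ^ n)"
  have abs: "summable (\<lambda>n. cmod (c n) * r ^ n)" if "r \<ge> 0" for r
  proof -
    have "summable (\<lambda>n. norm (c n * of_real r ^ n))"
      by (rule powser_insidea[of _ "of_real (r + 1)"])
        (use g[THEN sums_summable] that in auto)
    then show ?thesis using that by (simp add: norm_mult norm_power)
  qed
  have s_bound: "cmod (s N z) \<le> C" if "cmod z \<le> R" for N z
  proof -
    have "cmod (s N z) \<le> (\<Sum>n<N. cmod (c n) * \<bar>R\<bar> ^ n)"
      unfolding s_def using that
      by (intro sum_norm_le) (auto simp: norm_mult norm_power intro!: mult_left_mono power_mono)
    also have "\<dots> \<le> C"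
      unfolding C_def by (intro sum_le_suminf abs) auto
    finally show ?thesis .
  qed
  have "(\<lambda>N. \<integral>z. (cmod (s N z))\<^sup>2 * w z \<partial>lborel) \<longlonglongrightarrow> (\<integral>z. (cmod (g z))\<^sup>2 * w z \<partial>lborel)"
  proof (rule integral_dominated_convergence[where w = "\<lambda>z. indicator (cball 0 R) z * (C\<^sup>2 * \<bar>\<phi> (cmod z)\<bar>)"])
    show "integrable lborel (\<lambda>z::complex. indicator (cball 0 R) z * (C\<^sup>2 * \<bar>\<phi> (cmod z)\<bar>))"
      by (intro int continuous_intros phic)
    show "AE z in lborel. (\<lambda>N. (cmod (s N z))\<^sup>2 * w z) \<longlonglongrightarrow> (cmod (g z))\<^sup>2 * w z"
      by (intro AE_I2 tendsto_intros s_lim)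
    show "AE z in lborel. norm ((cmod (s N z))\<^sup>2 * w z) \<le> indicator (cball 0 R) z * (C\<^sup>2 * \<bar>\<phi> (cmod z)\<bar>)" for N
    proof (rule AE_I2)
      fix z :: complex
      show "norm ((cmod (s N z))\<^sup>2 * w z) \<le> indicator (cball 0 R) z * (C\<^sup>2 * \<bar>\<phi> (cmod z)\<bar>)"
      proof (cases "cmod z \<le> R")
        case True
        then have "(cmod (s N z))\<^sup>2 \<le> C\<^sup>2" by (intro power_mono s_bound) auto
        with True show ?thesis by (simp add: w_def abs_mult mult_right_mono)
      qed (simp add: w_def)
    qed
  qed simp_all
  then show ?thesis
    unfolding part by (simp add: sums_def w_def mult_ac)
qed

text \<open>The integrand \<open>h\<close> and its version \<open>k\<close> without mixed terms have
  equal integrals over every disc; monotone convergence along the radii \<open>0, 1, 2, ...\<close>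
  gives the whole plane, both sides being possibly infinite.\<close>

lemma power_series_mean_square:
  fixes \<phi> :: "real \<Rightarrow> real" and c :: "nat \<Rightarrow> complex"
  assumes cont: "continuous_on UNIV \<phi>" and pos: "\<And>r. \<phi> r \<ge> 0"
    and g: "\<And>z. (\<lambda>n. c n * z ^ n) sums g z"
  shows "(\<integral>\<^sup>+z. ennreal ((cmod (g z))\<^sup>2 * \<phi> (cmod z)) \<partial>lborel)
      = (\<Sum>n. ennreal ((cmod (c n))\<^sup>2) * (\<integral>\<^sup>+z. ennreal (cmod z ^ (2 * n) * \<phi> (cmod z)) \<partial>lborel))"
proof -
  have phim [measurable]: "\<phi> \<in> borel_measurable borel"
    using cont by (rule borel_measurable_continuous_onI)
  have phic: "continuous_on UNIV (\<lambda>z::complex. \<phi> (cmod z))"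
    by (intro continuous_on_compose2[OF cont] continuous_intros) auto
  have gm [measurable]: "g \<in> borel_measurable borel"
  proof (rule borel_measurable_LIMSEQ_metric)
    show "(\<lambda>N. \<Sum>n<N. c n * z ^ n) \<longlonglongrightarrow> g z" for z using g[of z] by (simp add: sums_def)
  qed simp
  define h where "h z = ennreal ((cmod (g z))\<^sup>2 * \<phi> (cmod z))" for z
  define k where "k z = (\<Sum>n. ennreal ((cmod (c n))\<^sup>2) * ennreal (cmod z ^ (2 * n) * \<phi> (cmod z)))" for z
  have [measurable]: "h \<in> borel_measurable borel" "k \<in> borel_measurable borel"
    unfolding h_def k_def by measurable
  have int: "integrable lborel (\<lambda>z. indicator (cball (0::complex) R) z * q z)"
    if "continuous_on UNIV q" for q :: "complex \<Rightarrow> real" and R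
    using borel_integrable_compact[of "cball (0::complex) R" q] continuous_on_subset[OF that] by auto
  have gc: "continuous_on UNIV g"
  proof -
    have "g = (\<lambda>z. \<Sum>n. c n * z ^ n)" using g by (auto simp: sums_iff)
    moreover have "isCont (\<lambda>z. \<Sum>n. c n * z ^ n) z" for z
      by (rule isCont_powser[of _ "of_real (cmod z + 1)"])
        (use g in \<open>auto simp: sums_iff\<close>)
    ultimately show ?thesis by (simp add: continuous_at_imp_continuous_on)
  qed
  have [measurable]: "cball (0::complex) R \<in> sets borel" for R by simp
  have disc: "(\<integral>\<^sup>+z. h z * indicator (cball (0::complex) R) z \<partial>lborel) = (\<integral>\<^sup>+z. k z * indicator (cball (0::complex) R) z \<partial>lborel)" for R
  proof -
    define m where "m n = (\<integral>z. indicator (cball (0::complex) R) z * (cmod z ^ (2 * n) * \<phi> (cmod z)) \<partial>lborel)" for n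
    have m: "ennreal (m n) = (\<integral>\<^sup>+z. ennreal (cmod z ^ (2 * n) * \<phi> (cmod z)) * indicator (cball (0::complex) R) z \<partial>lborel)" for n
    proof -
      have "integrable lborel (\<lambda>z. indicator (cball (0::complex) R) z * (cmod z ^ (2 * n) * \<phi> (cmod z)))"
        by (intro int continuous_intros phic)
      from nn_integral_eq_integral[OF this] have "ennreal (m n)
          = (\<integral>\<^sup>+z. ennreal (indicator (cball (0::complex) R) z * (cmod z ^ (2 * n) * \<phi> (cmod z))) \<partial>lborel)"
        using pos by (simp add: m_def)
      also have "\<dots> = (\<integral>\<^sup>+z. ennreal (cmod z ^ (2 * n) * \<phi> (cmod z)) * indicator (cball (0::complex) R) z \<partial>lborel)"
        by (intro nn_integral_cong) (auto simp: indicator_def)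
      finally show ?thesis .
    qed
    have mpos: "m n \<ge> 0" for n
      unfolding m_def using pos by (intro integral_nonneg_AE) auto
    have "(\<integral>\<^sup>+z. h z * indicator (cball (0::complex) R) z \<partial>lborel)
        = (\<integral>\<^sup>+z. ennreal (indicator (cball (0::complex) R) z * ((cmod (g z))\<^sup>2 * \<phi> (cmod z))) \<partial>lborel)"
      by (intro nn_integral_cong) (auto simp: h_def indicator_def)
    also have "\<dots> = ennreal (\<integral>z. indicator (cball (0::complex) R) z * ((cmod (g z))\<^sup>2 * \<phi> (cmod z)) \<partial>lborel)"
      by (rule nn_integral_eq_integral)
        (auto intro!: int continuous_intros phic gc AE_I2 mult_nonneg_nonneg pos)
    also have "\<dots> = (\<Sum>n. ennreal ((cmod (c n))\<^sup>2 * m n))"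
      using power_series_mean_square_disc[OF cont g, of R] mpos
      by (subst suminf_ennreal2) (auto simp: m_def[symmetric] sums_iff)
    also have "\<dots> = (\<Sum>n. \<integral>\<^sup>+z. ennreal ((cmod (c n))\<^sup>2) * ennreal (cmod z ^ (2 * n) * \<phi> (cmod z)) * indicator (cball (0::complex) R) z \<partial>lborel)"
      using mpos by (simp add: ennreal_mult m nn_integral_cmult mult.assoc)
    also have "\<dots> = (\<integral>\<^sup>+z. k z * indicator (cball (0::complex) R) z \<partial>lborel)"
      by (subst nn_integral_suminf[symmetric]) (simp_all add: k_def)
    finally show ?thesis .
  qed
  have lim: "(\<lambda>i. \<integral>\<^sup>+z. q z * indicator (cball (0::complex) (real i)) z \<partial>lborel) \<longlonglongrightarrow> (\<integral>\<^sup>+z. q z \<partial>lborel)"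
    if [measurable]: "q \<in> borel_measurable borel" for q :: "complex \<Rightarrow> ennreal"
  proof (rule nn_integral_LIMSEQ)
    show "incseq (\<lambda>i z. q z * indicator (cball (0::complex) (real i)) z)"
      by (auto simp: incseq_def le_fun_def split: split_indicator)
    show "(\<lambda>i. q z * indicator (cball (0::complex) (real i)) z) \<longlonglongrightarrow> q z" for z
    proof (rule tendsto_eventually)
      show "\<forall>\<^sub>F i in sequentially. q z * indicator (cball (0::complex) (real i)) z = q z"
        using eventually_ge_at_top[of "nat \<lceil>cmod z\<rceil>"]
        by eventually_elim (auto simp: indicator_def nat_ceiling_le_eq)
    qed
  qed simp
  have "(\<integral>\<^sup>+z. h z \<partial>lborel) = (\<integral>\<^sup>+z. k z \<partial>lborel)"
    by (rule LIMSEQ_unique[OF lim]) (use lim[of k] in \<open>simp_all add: disc\<close>)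
  also have "\<dots> = (\<Sum>n. ennreal ((cmod (c n))\<^sup>2) * (\<integral>\<^sup>+z. ennreal (cmod z ^ (2 * n) * \<phi> (cmod z)) \<partial>lborel))"
    unfolding k_def by (subst nn_integral_suminf) (simp_all add: nn_integral_cmult)
  finally show ?thesis by (simp add: h_def)
qed

text \<open>The weight \<open>|z|^(2 * k)\<close> shifts the Gaussian moment of index
  \<open>n\<close> to index \<open>n + k\<close>. Integrability excludes the value infinity, so the
  identity in \<open>ennreal\<close> becomes a convergent real series.\<close>

lemma power_series_gaussian_sums:
  fixes c :: "nat \<Rightarrow> complex"
  assumes g: "\<And>z. (\<lambda>n. c n * z ^ n) sums g z"
    and int: "integrable lborel (\<lambda>z. cmod z ^ (2 * k) * ((cmod (g z))\<^sup>2 * exp (- (cmod z)\<^sup>2)))"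
  shows "(\<lambda>n. (cmod (c n))\<^sup>2 * (pi * fact (n + k)))
    sums (\<integral>z. cmod z ^ (2 * k) * ((cmod (g z))\<^sup>2 * exp (- (cmod z)\<^sup>2)) \<partial>lborel)"
proof -
  let ?J = "\<integral>z. cmod z ^ (2 * k) * ((cmod (g z))\<^sup>2 * exp (- (cmod z)\<^sup>2)) \<partial>lborel"
  let ?a = "\<lambda>n. (cmod (c n))\<^sup>2 * (pi * fact (n + k))"
  define \<phi> where "\<phi> r = r ^ (2 * k) * exp (- r\<^sup>2)" for r :: real
  have "ennreal ?J = (\<integral>\<^sup>+z. ennreal (cmod z ^ (2 * k) * ((cmod (g z))\<^sup>2 * exp (- (cmod z)\<^sup>2))) \<partial>lborel)"
    using int by (intro nn_integral_eq_integral[symmetric]) auto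
  also have "\<dots> = (\<integral>\<^sup>+z. ennreal ((cmod (g z))\<^sup>2 * \<phi> (cmod z)) \<partial>lborel)"
    by (simp add: \<phi>_def mult_ac)
  also have "\<dots> = (\<Sum>n. ennreal ((cmod (c n))\<^sup>2) * (\<integral>\<^sup>+z. ennreal (cmod z ^ (2 * n) * \<phi> (cmod z)) \<partial>lborel))"
  proof (rule power_series_mean_square[OF _ _ g])
    show "continuous_on UNIV \<phi>" unfolding \<phi>_def by (intro continuous_intros)
  qed (simp add: \<phi>_def)
  also have "\<dots> = (\<Sum>n. ennreal (?a n))"
  proof (rule suminf_cong)
    fix n :: nat
    have "cmod z ^ (2 * n) * \<phi> (cmod z) = cmod z ^ (2 * (n + k)) * exp (- (cmod z)\<^sup>2)" for z
      by (simp add: \<phi>_def power_add[symmetric] algebra_simps)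
    then show "ennreal ((cmod (c n))\<^sup>2) * (\<integral>\<^sup>+z. ennreal (cmod z ^ (2 * n) * \<phi> (cmod z)) \<partial>lborel) = ennreal (?a n)"
      by (simp only: nn_integral_gaussian_moment) (simp add: ennreal_mult)
  qed
  finally have eq: "ennreal ?J = (\<Sum>n. ennreal (?a n))" .
  have s: "summable ?a"
  proof (rule summable_suminf_not_top)
    show "(\<Sum>n. ennreal (?a n)) \<noteq> top" unfolding eq[symmetric] by (rule ennreal_neq_top)
  qed simp
  have "ennreal ?J = ennreal (\<Sum>n. ?a n)"
    unfolding eq by (rule suminf_ennreal2[OF _ s]) simp
  moreover have "?J \<ge> 0" by (intro integral_nonneg_AE) auto
  moreover have "(\<Sum>n. ?a n) \<ge> 0" by (intro suminf_nonneg s) auto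
  ultimately have "?J = (\<Sum>n. ?a n)" by (simp only: ennreal_inj)
  with s show ?thesis by (simp add: summable_sums)
qed

text \<open>Termwise, \<open>(n + 1)! - 3 * n!\<close> is \<open>n! * (n - 2)\<close>. It is
  negative for \<open>n = 0\<close>, where \<open>2 * pi * (cmod (g 0))\<^sup>2\<close> compensates
  it exactly, and for \<open>n = 1\<close>, where \<open>c 1 = 0\<close> removes the term; it is
  zero for \<open>n = 2\<close> and positive afterwards. The last inequality keeps only the term
  \<open>n = 0\<close> of the mass series; it later controls the quartic integral.\<close>

lemma gaussian_deficit:
  fixes c :: "nat \<Rightarrow> complex"
  assumes g: "\<And>z. (\<lambda>n. c n * z ^ n) sums g z" and c1: "c 1 = 0"
    and int0: "integrable lborel (\<lambda>z. (cmod (g z))\<^sup>2 * exp (- (cmod z)\<^sup>2))"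
    and int1: "integrable lborel (\<lambda>z. (cmod z)\<^sup>2 * ((cmod (g z))\<^sup>2 * exp (- (cmod z)\<^sup>2)))"
  defines "D \<equiv> (\<integral>z. (cmod z)\<^sup>2 * ((cmod (g z))\<^sup>2 * exp (- (cmod z)\<^sup>2)) \<partial>lborel)
      + 2 * pi * (cmod (g 0))\<^sup>2 - 3 * (\<integral>z. (cmod (g z))\<^sup>2 * exp (- (cmod z)\<^sup>2) \<partial>lborel)"
  shows "D \<ge> 0" and "D = 0 \<longleftrightarrow> (\<forall>n\<ge>3. c n = 0)"
    and "pi * (cmod (g 0))\<^sup>2 \<le> (\<integral>z. (cmod (g z))\<^sup>2 * exp (- (cmod z)\<^sup>2) \<partial>lborel)"
proof -
  have g0: "g 0 = c 0"
    using g[of 0] powser_sums_zero_iff[of c "g 0"] by simp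
  have s0: "(\<lambda>n. (cmod (c n))\<^sup>2 * (pi * fact n)) sums (\<integral>z. (cmod (g z))\<^sup>2 * exp (- (cmod z)\<^sup>2) \<partial>lborel)"
    using power_series_gaussian_sums[OF g, where k = 0] int0 by simp
  have s1: "(\<lambda>n. (cmod (c n))\<^sup>2 * (pi * fact (n + 1)))
      sums (\<integral>z. (cmod z)\<^sup>2 * ((cmod (g z))\<^sup>2 * exp (- (cmod z)\<^sup>2)) \<partial>lborel)"
    using power_series_gaussian_sums[OF g, where k = 1] int1 by simp
  have s2: "(\<lambda>n. if n = 0 then 2 * pi * (cmod (c n))\<^sup>2 else 0) sums (2 * pi * (cmod (g 0))\<^sup>2)"
    using sums_single[of 0 "\<lambda>n. 2 * pi * (cmod (c n))\<^sup>2"] by (simp add: g0)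
  define d where "d n = (if n < 3 then 0 else (cmod (c n))\<^sup>2 * (pi * fact n) * (real n - 2))" for n
  have "(\<lambda>n. (cmod (c n))\<^sup>2 * (pi * fact (n + 1)) + (if n = 0 then 2 * pi * (cmod (c n))\<^sup>2 else 0)
      - 3 * ((cmod (c n))\<^sup>2 * (pi * fact n))) sums D"
    unfolding D_def by (intro sums_diff sums_add sums_mult s0 s1 s2)
  also have "(\<lambda>n. (cmod (c n))\<^sup>2 * (pi * fact (n + 1)) + (if n = 0 then 2 * pi * (cmod (c n))\<^sup>2 else 0)
      - 3 * ((cmod (c n))\<^sup>2 * (pi * fact n))) = d"
  proof
    fix n :: nat
    consider "n = 0" | "n = 1" | "n = 2" | "n \<ge> 3" by linarith
    then show "(cmod (c n))\<^sup>2 * (pi * fact (n + 1)) + (if n = 0 then 2 * pi * (cmod (c n))\<^sup>2 else 0)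
      - 3 * ((cmod (c n))\<^sup>2 * (pi * fact n)) = d n"
    proof cases
      case 2 then show ?thesis using c1 by (simp add: d_def)
    next
      case 3 then show ?thesis by (simp add: d_def numeral_2_eq_2)
    next
      case 4 then show ?thesis by (simp add: d_def algebra_simps)
    qed (simp add: d_def)
  qed
  finally have d: "d sums D" .
  have dpos: "d n \<ge> 0" for n by (simp add: d_def)
  show "D \<ge> 0" using sums_le[OF dpos sums_zero d] by simp
  have "D = 0 \<longleftrightarrow> (\<forall>n. d n = 0)"
    using suminf_eq_zero_iff[OF sums_summable[OF d] dpos] d by (simp add: sums_iff)
  also have "\<dots> \<longleftrightarrow> (\<forall>n\<ge>3. c n = 0)"
    by (auto simp: d_def not_less)
  finally show "D = 0 \<longleftrightarrow> (\<forall>n\<ge>3. c n = 0)" .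
  show "pi * (cmod (g 0))\<^sup>2 \<le> (\<integral>z. (cmod (g z))\<^sup>2 * exp (- (cmod z)\<^sup>2) \<partial>lborel)"
    using sum_le_suminf[OF sums_summable[OF s0], of "{0}"] s0 by (simp add: sums_iff g0 mult_ac)
qed

subsection \<open>The functional equation\<close>

lemma continuous_eq_off_finite:
  fixes f g :: "complex \<Rightarrow> complex"
  assumes "continuous_on UNIV f" "continuous_on UNIV g" "finite S" "\<And>z. z \<notin> S \<Longrightarrow> f z = g z"
  shows "f z = g z"
proof -
  have "closure (- S) = UNIV"
    using \<open>finite S\<close> by (simp add: closure_complement empty_interior_finite)
  then show ?thesis
    using continuous_constant_on_closure[of "- S" "\<lambda>z. f z - g z" 0 z] assms
    by (auto intro: continuous_intros)
qed

text \<open>Both \<open>h x * h y\<close> and \<open>h (x + y) * h 0\<close> are the square of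
  \<open>h\<close> at the midpoint of \<open>x\<close> and \<open>y\<close>. Hence
  \<open>E = h / h 0\<close> turns sums into products, so \<open>E' = a * E\<close> with
  \<open>a = E' 0\<close>, and \<open>E z * exp (- a * z)\<close> is constant.\<close>

lemma entire_multiplicative_exp:
  fixes h :: "complex \<Rightarrow> complex"
  assumes hol: "h holomorphic_on UNIV" and nz: "\<And>z. h z \<noteq> 0"
    and mult: "\<And>Z w. h (Z + w) * h (Z - w) = (h Z)\<^sup>2"
  shows "\<exists>c a. c \<noteq> 0 \<and> h = (\<lambda>z. c * exp (a * z))"
proof -
  define E where "E z = h z / h 0" for z
  have E0: "E 0 = 1" using nz by (simp add: E_def)
  have half: "h x * h y = (h ((x + y) / 2))\<^sup>2" for x y
    using mult[of "(x + y) / 2" "(x - y) / 2"] by (simp add: field_simps)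
  have add: "E (x + y) = E x * E y" for x y
  proof -
    have "h x * h y = h (x + y) * h 0"
      using half[of x y] half[of "x + y" 0] by simp
    then show ?thesis using nz[of 0] by (simp add: E_def field_simps)
  qed
  have Ehol: "E holomorphic_on UNIV"
    unfolding E_def using nz by (intro holomorphic_intros hol)
  define a where "a = deriv E 0"
  have d0: "(E has_field_derivative a) (at 0)"
    using Ehol unfolding a_def by (simp add: holomorphic_derivI)
  have dE: "(E has_field_derivative (a * E x)) (at x)" for x
  proof -
    have "((\<lambda>y. E (y - x)) has_field_derivative a * 1) (at x)"
      by (rule DERIV_chain2[where f = E and g = "\<lambda>y. y - x"])
        (use d0 in \<open>auto intro!: derivative_eq_intros\<close>)
    then have "((\<lambda>y. E (y - x)) has_field_derivative a) (at x)" by simp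
    then have "((\<lambda>y. E (y - x) * E x) has_field_derivative (a * E x)) (at x)"
      by (rule DERIV_cmult_right)
    moreover have "(\<lambda>y. E (y - x) * E x) = E" by (simp add: fun_eq_iff flip: add)
    ultimately show ?thesis by simp
  qed
  have "((\<lambda>z. E z * exp (- a * z)) has_field_derivative 0) (at x)" for x
    by (auto intro!: derivative_eq_intros dE simp: algebra_simps)
  then obtain k where k: "\<And>z. E z * exp (- a * z) = k"
    using has_field_derivative_zero_constant[of UNIV "\<lambda>z. E z * exp (- a * z)"] by auto
  have "k = 1" using k[of 0] E0 by simp
  have "h z = h 0 * exp (a * z)" for z
  proof -
    have "E z * (exp (- a * z) * exp (a * z)) = exp (a * z)"
      using k[of z] \<open>k = 1\<close> by (simp add: mult.assoc[symmetric])
    then have "E z = exp (a * z)" by (simp add: exp_add[symmetric])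
    then show ?thesis using nz[of 0] by (simp add: E_def field_simps)
  qed
  with nz[of 0] show ?thesis by blast
qed

text \<open>Entire functions have no zero divisors: \<open>g\<close> vanishes on the nonempty open
  set where \<open>f\<close> does not, hence everywhere by the identity theorem.\<close>

lemma entire_product_zero:
  fixes f g :: "complex \<Rightarrow> complex"
  assumes "f holomorphic_on UNIV" "g holomorphic_on UNIV" "\<And>z. f z * g z = 0" "f z0 \<noteq> 0"
  shows "g z = 0"
proof -
  have c: "continuous_on UNIV f" using assms(1) by (rule holomorphic_on_imp_continuous_on)
  have "open {z. f z \<noteq> 0}" using open_Collect_neq[OF c continuous_on_const, of 0] .
  moreover have "g z = 0" if "z \<in> {z. f z \<noteq> 0}" for z using assms(3)[of z] that by simp
  ultimately show ?thesis
    using analytic_continuation_open[of "{z. f z \<noteq> 0}" UNIV g "\<lambda>_. 0" z] assms(2,4) by auto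
qed

text \<open>The two forms are the zero-free case and the case of a single simple zero
  \<open>p\<close>. In the latter, dividing by \<open>z - p\<close> leaves a zero-free function
  satisfying the midpoint identity of \<open>entire_multiplicative_exp\<close>.\<close>

lemma entire_quadratic_product:
  fixes f B :: "complex \<Rightarrow> complex"
  assumes hol: "f holomorphic_on UNIV" and nz: "f z0 \<noteq> 0"
    and eq: "\<And>Z w. f (Z + w) * f (Z - w) = (f Z)\<^sup>2 + w\<^sup>2 * B Z"
  shows "\<exists>c a. c \<noteq> 0 \<and> ((f = (\<lambda>z. c * exp (a * z))) \<or> (\<exists>p. f = (\<lambda>z. c * (z - p) * exp (a * z))))"
proof (cases "\<exists>p. f p = 0")
  case False
  \<comment> \<open>Otherwise the right side, a nonconstant quadratic in \<open>w\<close>, has a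
    root, and this root produces a zero of \<open>f\<close>.\<close>
  have "B Z = 0" for Z
  proof (rule ccontr)
    assume b: "B Z \<noteq> 0"
    define w where "w = csqrt (- ((f Z)\<^sup>2 / B Z))"
    have "w\<^sup>2 * B Z = - (f Z)\<^sup>2" using b by (simp add: w_def)
    then have "f (Z + w) * f (Z - w) = 0" by (simp add: eq)
    then show False using False by auto
  qed
  then show ?thesis using entire_multiplicative_exp[OF hol] False eq by auto
next
  case True
  then obtain p where p: "f p = 0" by blast
  have eqp: "f (p + w) * f (p - w) = w\<^sup>2 * B p" for w by (simp add: eq p)
  \<comment> \<open>If \<open>B p = 0\<close>, the product of \<open>f (p + w)\<close> and
    \<open>f (p - w)\<close> vanishes identically in \<open>w\<close>, so \<open>f\<close> itself
    would vanish identically.\<close>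
  have Bp: "B p \<noteq> 0"
  proof
    assume "B p = 0"
    then have 0: "f (p + w) * f (p - w) = 0" for w using eqp by simp
    have h1: "(\<lambda>w. f (p + w)) holomorphic_on UNIV" "(\<lambda>w. f (p - w)) holomorphic_on UNIV"
      by (auto intro!: holomorphic_on_compose_gen[OF _ hol, unfolded o_def] holomorphic_intros)
    have "f (p - w) = 0" for w
      using entire_product_zero[OF h1 0, of "z0 - p" w] nz by simp
    from this[of "p - z0"] nz show False by simp
  qed
  define h where "h z = (if z = p then deriv f p else f z / (z - p))" for z
  have fh: "f z = (z - p) * h z" for z by (simp add: h_def p)
  have hhol: "h holomorphic_on UNIV"
    by (rule pole_theorem_open_0[OF hol open_UNIV, of p]) (auto simp: fh p, simp add: h_def)
  have hc: "continuous_on UNIV h" using hhol by (rule holomorphic_on_imp_continuous_on)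
  have hc': "continuous_on UNIV (\<lambda>w. h (Z + w) * h (Z - w))" for Z
    by (intro continuous_intros continuous_on_compose2[OF hc]) auto
  \<comment> \<open>Taking \<open>w = Z - p\<close> makes the factor \<open>f (Z - w)\<close> vanish
    and gives \<open>(f Z)\<^sup>2 = - (Z - p)\<^sup>2 * B Z\<close>. Then both sides of the
    equation carry the factor \<open>(Z - p)\<^sup>2 - w\<^sup>2\<close>; it is cancelled away from
    its two roots, which continuity restores.\<close>
  have key: "h (Z + w) * h (Z - w) = - B Z" for Z w
  proof (rule continuous_eq_off_finite[where S = "{Z - p, p - Z}"
        and f = "\<lambda>w. h (Z + w) * h (Z - w)" and g = "\<lambda>_. - B Z"])
    fix w assume "w \<notin> {Z - p, p - Z}"
    then have "w \<noteq> Z - p" "w \<noteq> - (Z - p)" by auto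
    then have n: "(Z - p)\<^sup>2 - w\<^sup>2 \<noteq> 0" by (metis eq_iff_diff_eq_0 minus_minus power2_eq_iff)
    have "(f Z)\<^sup>2 + (Z - p)\<^sup>2 * B Z = 0"
      using eq[of Z "Z - p"] p by (simp add: algebra_simps)
    then have "((Z - p)\<^sup>2 - w\<^sup>2) * (h (Z + w) * h (Z - w)) = ((Z - p)\<^sup>2 - w\<^sup>2) * (- B Z)"
      using eq[of Z w] by (simp add: fh[of "Z + w"] fh[of "Z - w"]) algebra
    then show "h (Z + w) * h (Z - w) = - B Z" by (rule mult_left_cancel[OF n, THEN iffD1])
  qed (use hc' in \<open>auto intro: continuous_intros\<close>)
  have hmult: "h (Z + w) * h (Z - w) = (h Z)\<^sup>2" for Z w
    using key[of Z w] key[of Z 0] by (simp add: power2_eq_square)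
  \<comment> \<open>By \<open>key\<close> at centre \<open>p\<close>, the values of \<open>h\<close>
    at \<open>z\<close> and at its mirror image in \<open>p\<close> multiply to
    \<open>- B p\<close>.\<close>
  have "h z \<noteq> 0" for z
    using key[of p "z - p"] Bp by auto
  from entire_multiplicative_exp[OF hhol this hmult]
  obtain c a where "c \<noteq> 0" "h = (\<lambda>z. c * exp (a * z))" by blast
  then have "c \<noteq> 0 \<and> f = (\<lambda>z. c * (z - p) * exp (a * z))" by (auto simp: fh)
  then show ?thesis by blast
qed

subsection \<open>The energy identity\<close>

lemma integrable_lborel_product:
  fixes f g :: "complex \<Rightarrow> real"
  assumes f: "integrable lborel f" and g: "integrable lborel g"
  shows "integrable (lborel \<Otimes>\<^sub>M lborel) (\<lambda>(x, y). f x * g y)"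
    and "(\<integral>x. (case x of (x, y) \<Rightarrow> f x * g y) \<partial>(lborel \<Otimes>\<^sub>M lborel)) = (\<integral>x. f x \<partial>lborel) * (\<integral>y. g y \<partial>lborel)"
proof -
  have [measurable]: "f \<in> borel_measurable borel" "g \<in> borel_measurable borel"
    using f g by (auto dest: borel_measurable_integrable)
  show i: "integrable (lborel \<Otimes>\<^sub>M lborel) (\<lambda>(x, y). f x * g y)"
  proof (rule lborel_pair.Fubini_integrable)
    show "integrable lborel (\<lambda>x. LINT y|lborel. norm (case (x, y) of (x, y) \<Rightarrow> f x * g y))"
      using f by (simp add: abs_mult integrable_abs)
  qed (use g in auto)
  show "(\<integral>x. (case x of (x, y) \<Rightarrow> f x * g y) \<partial>(lborel \<Otimes>\<^sub>M lborel)) = (\<integral>x. f x \<partial>lborel) * (\<integral>y. g y \<partial>lborel)"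
    using lborel_pair.integral_fst'[OF i] by simp
qed

text \<open>Evenness is reduced to \<open>c 1 = 0\<close>, as 1 is the only odd index whose weight
  in the deficit is negative.\<close>

lemma entire_even_power_series:
  fixes g :: "complex \<Rightarrow> complex"
  assumes hol: "g holomorphic_on UNIV" and even: "\<And>w. g (- w) = g w"
  obtains c where "\<And>z. (\<lambda>n. c n * z ^ n) sums g z" "c 1 = 0"
proof
  define c where "c n = (deriv ^^ n) g 0 / fact n" for n
  show "(\<lambda>n. c n * z ^ n) sums g z" for z
    using holomorphic_power_series[of g 0 "cmod z + 1" z] holomorphic_on_subset[OF hol]
    by (simp add: c_def)
  have d: "(g has_field_derivative deriv g 0) (at 0)"
    using hol by (simp add: holomorphic_derivI)
  have "((\<lambda>w. g (- w)) has_field_derivative deriv g 0 * (- 1)) (at 0)"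
    by (rule DERIV_chain2[where f = g and g = uminus]) (use d in \<open>auto intro!: derivative_eq_intros\<close>)
  then have "(g has_field_derivative deriv g 0 * (- 1)) (at 0)" by (simp only: even)
  from DERIV_unique[OF d this] have "2 * deriv g 0 = 0" by algebra
  then show "c 1 = 0" by (simp add: c_def)
qed

section \<open>States of unit mass with finite second moment, and their slices\<close>

text \<open>Exactly the states with finite energy: \<open>fock_state_of_finite_energy\<close> gives
  one direction, and integrability of \<open>|u|^4\<close> is derived inside as
  \<open>integrable_p_sq\<close>.\<close>

locale fock_state =
  fixes f u :: "complex \<Rightarrow> complex"
  assumes hol: "f holomorphic_on UNIV"
    and u_eq: "u = (\<lambda>z. complex_of_real (exp (- (norm z)\<^sup>2 / 2)) * f z)"
    and int0: "integrable lborel (\<lambda>z. (cmod (u z))\<^sup>2)"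
    and int1: "integrable lborel (\<lambda>z. (cmod z)\<^sup>2 * (cmod (u z))\<^sup>2)"
    and mass: "(\<integral>z. (cmod (u z))\<^sup>2 \<partial>lborel) = 1"
begin

definition p :: "complex \<Rightarrow> real" where "p z = (cmod (u z))\<^sup>2"
definition S :: real where "S = (\<integral>z. (cmod z)\<^sup>2 * p z \<partial>lborel)"
definition I4 :: real where "I4 = (\<integral>z. (p z)\<^sup>2 \<partial>lborel)"
definition Qre :: real where "Qre = (\<integral>z. Re z * p z \<partial>lborel)"
definition Qim :: real where "Qim = (\<integral>z. Im z * p z \<partial>lborel)"

text \<open>The two-particle state in centre-of-mass coordinate \<open>Z\<close> and relative
  coordinate \<open>w\<close>. Exchanging the particles is \<open>w \<mapsto> - w\<close>, which
  makes \<open>F Z\<close> even.\<close>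

definition F :: "complex \<Rightarrow> complex \<Rightarrow> complex" where
  "F Z w = f ((Z + w) / of_real (sqrt 2)) * f ((Z - w) / of_real (sqrt 2))"
definition K :: "complex \<Rightarrow> complex \<Rightarrow> real" where
  "K Z w = p ((Z + w) / of_real (sqrt 2)) * p ((Z - w) / of_real (sqrt 2))"
text \<open>The deficit of the slice at \<open>Z\<close>, with the factor
  \<open>exp (- (cmod Z)\<^sup>2)\<close> already contained in \<open>K\<close>. Where a slice is
  not integrable the integrals take their default value 0, so statements about \<open>D\<close> hold
  almost everywhere.\<close>

definition D :: "complex \<Rightarrow> real" where
  "D Z = (\<integral>w. (cmod w)\<^sup>2 * K Z w \<partial>lborel) + 2 * pi * K Z 0 - 3 * (\<integral>w. K Z w \<partial>lborel)"

lemma p_nonneg [simp]: "p z \<ge> 0" by (simp add: p_def)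

lemma f_continuous: "continuous_on UNIV f"
  using hol by (rule holomorphic_on_imp_continuous_on)

lemma p_eq: "p z = exp (- (cmod z)\<^sup>2) * (cmod (f z))\<^sup>2"
proof -
  have "exp (- (cmod z)\<^sup>2 / 2) ^ 2 = exp (- (cmod z)\<^sup>2)"
    by (simp only: power2_eq_square[of "exp _"] exp_add[symmetric]) simp
  moreover have "u z = complex_of_real (exp (- (norm z)\<^sup>2 / 2)) * f z"
    by (simp only: u_eq)
  ultimately show ?thesis by (simp add: p_def norm_mult power_mult_distrib)
qed

lemma p_measurable [measurable]: "p \<in> borel_measurable borel"
proof -
  have "continuous_on UNIV p"
    unfolding p_eq[abs_def] by (intro continuous_intros f_continuous)
  then show ?thesis by (rule borel_measurable_continuous_onI)
qed

lemma F_holomorphic: "F Z holomorphic_on UNIV"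
proof -
  have comp: "(\<lambda>w. f (g w)) holomorphic_on UNIV" if "g holomorphic_on UNIV" for g
    using holomorphic_on_compose_gen[OF that hol] by (simp add: o_def)
  have "(\<lambda>w. (Z + w) / of_real (sqrt 2)) holomorphic_on UNIV" "(\<lambda>w. (Z - w) / of_real (sqrt 2)) holomorphic_on UNIV"
    by (intro holomorphic_intros, simp)+
  then show ?thesis
    unfolding F_def[abs_def] by (intro holomorphic_on_mult comp)
qed

text \<open>By the parallelogram law \<open>|z1|^2 + |z2|^2 = |Z|^2 + |w|^2\<close>, so the Gaussian
  factors separate and each slice is an entire function in a Gaussian space.\<close>

lemma K_eq: "K Z w = exp (- (cmod Z)\<^sup>2) * ((cmod (F Z w))\<^sup>2 * exp (- (cmod w)\<^sup>2))"
proof -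
  define x y where "x = (Z + w) / of_real (sqrt 2)" and "y = (Z - w) / of_real (sqrt 2)"
  have "(cmod (Z + w))\<^sup>2 + (cmod (Z - w))\<^sup>2 = 2 * ((cmod Z)\<^sup>2 + (cmod w)\<^sup>2)"
    unfolding cmod_power2 by (simp add: power2_eq_square algebra_simps)
  then have "- (cmod x)\<^sup>2 + - (cmod y)\<^sup>2 = - (cmod Z)\<^sup>2 + - (cmod w)\<^sup>2"
    by (simp add: x_def y_def norm_divide power_divide)
  then have e: "exp (- (cmod x)\<^sup>2) * exp (- (cmod y)\<^sup>2) = exp (- (cmod Z)\<^sup>2) * exp (- (cmod w)\<^sup>2)"
    by (simp only: exp_add[symmetric])
  have "K Z w = exp (- (cmod x)\<^sup>2) * exp (- (cmod y)\<^sup>2) * ((cmod (f x))\<^sup>2 * (cmod (f y))\<^sup>2)"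
    by (simp add: K_def p_eq x_def y_def)
  also have "(cmod (f x))\<^sup>2 * (cmod (f y))\<^sup>2 = (cmod (F Z w))\<^sup>2"
    by (simp add: F_def norm_mult power_mult_distrib x_def y_def)
  finally show ?thesis unfolding e by simp
qed

text \<open>This is \<open>gaussian_deficit\<close> for the even entire function \<open>F Z\<close>,
  multiplied by the positive number \<open>exp (- (cmod Z)\<^sup>2)\<close>.\<close>

lemma slice_deficit:
  assumes i0: "integrable lborel (K Z)" and i1: "integrable lborel (\<lambda>w. (cmod w)\<^sup>2 * K Z w)"
  shows "D Z \<ge> 0" and "D Z = 0 \<longleftrightarrow> (\<exists>A B. \<forall>w. F Z w = A + w\<^sup>2 * B)"
    and "pi * K Z 0 \<le> (\<integral>w. K Z w \<partial>lborel)"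
proof -
  define e where "e = exp (- (cmod Z)\<^sup>2)"
  have e: "e > 0" by (simp add: e_def)
  have K: "K Z w = e * ((cmod (F Z w))\<^sup>2 * exp (- (cmod w)\<^sup>2))" for w
    by (simp add: K_eq e_def)
  have Kw: "(cmod w)\<^sup>2 * K Z w = e * ((cmod w)\<^sup>2 * ((cmod (F Z w))\<^sup>2 * exp (- (cmod w)\<^sup>2)))" for w
    by (simp add: K)
  have j0: "integrable lborel (\<lambda>w. (cmod (F Z w))\<^sup>2 * exp (- (cmod w)\<^sup>2))"
    using i0 e unfolding K[abs_def] by simp
  have j1: "integrable lborel (\<lambda>w. (cmod w)\<^sup>2 * ((cmod (F Z w))\<^sup>2 * exp (- (cmod w)\<^sup>2)))"
    using i1 e unfolding Kw by simp
  define d where "d = (\<integral>w. (cmod w)\<^sup>2 * ((cmod (F Z w))\<^sup>2 * exp (- (cmod w)\<^sup>2)) \<partial>lborel)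
      + 2 * pi * (cmod (F Z 0))\<^sup>2 - 3 * (\<integral>w. (cmod (F Z w))\<^sup>2 * exp (- (cmod w)\<^sup>2) \<partial>lborel)"
  have D: "D Z = e * d"
    unfolding D_def Kw unfolding K d_def by (simp add: algebra_simps)
  have even: "F Z (- w) = F Z w" for w by (simp add: F_def)
  obtain c where c: "\<And>z. (\<lambda>n. c n * z ^ n) sums F Z z" "c 1 = 0"
    using entire_even_power_series[OF F_holomorphic even] by blast
  note def = gaussian_deficit[OF _ _ j0 j1, folded d_def]
  show "D Z \<ge> 0" using def(1)[OF c] e by (simp add: D)
  show "pi * K Z 0 \<le> (\<integral>w. K Z w \<partial>lborel)"
    using def(3)[OF c] e by (simp add: K)
  show "D Z = 0 \<longleftrightarrow> (\<exists>A B. \<forall>w. F Z w = A + w\<^sup>2 * B)"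
  proof
    assume "D Z = 0"
    then have z: "\<forall>n\<ge>3. c n = 0" using def(2)[OF c] e by (simp add: D)
    have "F Z w = c 0 + w\<^sup>2 * c 2" for w
    proof -
      have "(\<lambda>n. c n * w ^ n) sums (\<Sum>n<3. c n * w ^ n)"
        by (rule sums_finite) (use z in \<open>auto simp: not_less\<close>)
      then have "F Z w = (\<Sum>n<3. c n * w ^ n)" using c(1) sums_unique2 by blast
      then show ?thesis using c(2) by (simp add: numeral_3_eq_3 numeral_2_eq_2)
    qed
    then show "\<exists>A B. \<forall>w. F Z w = A + w\<^sup>2 * B" by blast
  next
    assume "\<exists>A B. \<forall>w. F Z w = A + w\<^sup>2 * B"
    then obtain A B where AB: "\<And>w. F Z w = A + w\<^sup>2 * B" by blast
    \<comment> \<open>\<open>gaussian_deficit\<close> accepts any coefficient sequence summing to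
      \<open>F Z\<close>, so the explicit quadratic one avoids a uniqueness argument.\<close>
    define b where "b n = (if n = 0 then A else if n = 2 then B else 0)" for n :: nat
    have "(\<lambda>n. b n * w ^ n) sums F Z w" for w
    proof -
      have "(\<lambda>n. b n * w ^ n) sums (\<Sum>n\<in>{0, 2}. b n * w ^ n)"
        by (rule sums_finite) (auto simp: b_def)
      then show ?thesis by (simp add: b_def AB mult.commute)
    qed
    from def(2)[OF this] have "d = 0" by (simp add: b_def)
    then show "D Z = 0" by (simp add: D)
  qed
qed

lemma int_p: "integrable lborel p" and int_zp: "integrable lborel (\<lambda>z. (cmod z)\<^sup>2 * p z)"
  and mass_p: "integral\<^sup>L lborel p = 1"
  using int0 int1 mass by (simp_all add: p_def[abs_def])

lemma int_linear_p: "integrable lborel (\<lambda>z. Re z * p z)" "integrable lborel (\<lambda>z. Im z * p z)"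
proof -
  have i: "integrable lborel (\<lambda>z. p z + (cmod z)\<^sup>2 * p z)"
    by (intro Bochner_Integration.integrable_add int_p int_zp)
  have b: "\<bar>t\<bar> \<le> 1 + (cmod z)\<^sup>2" if "\<bar>t\<bar> \<le> cmod z" for t z
  proof -
    have "cmod z \<le> 1 + (cmod z)\<^sup>2"
      using zero_le_power2[of "cmod z - 1 / 2"] by (simp add: power2_eq_square algebra_simps)
    with that show ?thesis by linarith
  qed
  have c: "\<bar>t * p z\<bar> \<le> \<bar>p z + (cmod z)\<^sup>2 * p z\<bar>" if "\<bar>t\<bar> \<le> cmod z" for t z
    using mult_right_mono[OF b[OF that] p_nonneg[of z]] by (simp add: abs_mult algebra_simps)
  show "integrable lborel (\<lambda>z. Re z * p z)"
    by (rule Bochner_Integration.integrable_bound[OF i]) (use c abs_Re_le_cmod in auto)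
  show "integrable lborel (\<lambda>z. Im z * p z)"
    by (rule Bochner_Integration.integrable_bound[OF i]) (use c abs_Im_le_cmod in auto)
qed

section \<open>Integrals of \<open>K\<close> by the measure-preserving change of coordinates\<close>

definition turn :: "complex \<times> complex \<Rightarrow> complex \<times> complex" where
  "turn = (\<lambda>(Z, w). ((Z + w) / of_real (sqrt 2), (Z - w) / of_real (sqrt 2)))"

lemma turn_measurable [measurable]: "turn \<in> lborel \<Otimes>\<^sub>M lborel \<rightarrow>\<^sub>M lborel \<Otimes>\<^sub>M lborel"
  unfolding turn_def by measurable

lemma integrable_turn:
  fixes h :: "complex \<times> complex \<Rightarrow> real"
  assumes h: "integrable (lborel \<Otimes>\<^sub>M lborel) h"
  shows "integrable (lborel \<Otimes>\<^sub>M lborel) (\<lambda>x. h (turn x))"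
    and "(\<integral>x. h (turn x) \<partial>(lborel \<Otimes>\<^sub>M lborel)) = (\<integral>x. h x \<partial>(lborel \<Otimes>\<^sub>M lborel))"
proof -
  have d: "distr (lborel \<Otimes>\<^sub>M lborel) (lborel \<Otimes>\<^sub>M lborel) turn = lborel \<Otimes>\<^sub>M lborel"
    unfolding turn_def by (rule distr_lborel_half_turn)
  show "integrable (lborel \<Otimes>\<^sub>M lborel) (\<lambda>x. h (turn x))"
    by (rule integrable_distr[OF turn_measurable]) (simp only: d h)
  show "(\<integral>x. h (turn x) \<partial>(lborel \<Otimes>\<^sub>M lborel)) = (\<integral>x. h x \<partial>(lborel \<Otimes>\<^sub>M lborel))"
    using integral_distr[OF turn_measurable borel_measurable_integrable[OF h]] by (simp only: d)
qed

lemma K_integral: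
  shows "integrable (lborel \<Otimes>\<^sub>M lborel) (\<lambda>(Z, w). K Z w)"
    and "(\<integral>x. (case x of (Z, w) \<Rightarrow> K Z w) \<partial>(lborel \<Otimes>\<^sub>M lborel)) = 1"
proof -
  have K: "(\<lambda>(Z, w). K Z w) = (\<lambda>x. (case turn x of (z1, z2) \<Rightarrow> p z1 * p z2))"
    by (auto simp: turn_def K_def)
  note pp = integrable_lborel_product[OF int_p int_p]
  show "integrable (lborel \<Otimes>\<^sub>M lborel) (\<lambda>(Z, w). K Z w)"
    unfolding K by (rule integrable_turn(1)[OF pp(1)])
  show "(\<integral>x. (case x of (Z, w) \<Rightarrow> K Z w) \<partial>(lborel \<Otimes>\<^sub>M lborel)) = 1"
    unfolding K integrable_turn(2)[OF pp(1)] pp(2) mass_p by simp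
qed

text \<open>Here the first moment enters: \<open>w = (z1 - z2) / sqrt 2\<close>, so
  \<open>|w|^2\<close> is the mean of \<open>|z1|^2\<close> and \<open>|z2|^2\<close> minus
  \<open>Re (z1 * cnj z2)\<close>. Against the product density the mean gives \<open>S\<close>, and
  the mixed term factorizes into the squares of \<open>Qre\<close> and \<open>Qim\<close>.\<close>

lemma weighted_K_integral:
  shows "integrable (lborel \<Otimes>\<^sub>M lborel) (\<lambda>(Z, w). (cmod w)\<^sup>2 * K Z w)"
    and "(\<integral>x. (case x of (Z, w) \<Rightarrow> (cmod w)\<^sup>2 * K Z w) \<partial>(lborel \<Otimes>\<^sub>M lborel)) = S - (Qre\<^sup>2 + Qim\<^sup>2)"
proof -
  define h :: "complex \<times> complex \<Rightarrow> real" where "h = (\<lambda>x.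
      1 / 2 * (case x of (z1, z2) \<Rightarrow> ((cmod z1)\<^sup>2 * p z1) * p z2)
    + 1 / 2 * (case x of (z1, z2) \<Rightarrow> p z1 * ((cmod z2)\<^sup>2 * p z2))
    - (case x of (z1, z2) \<Rightarrow> (Re z1 * p z1) * (Re z2 * p z2))
    - (case x of (z1, z2) \<Rightarrow> (Im z1 * p z1) * (Im z2 * p z2)))"
  note q = integrable_lborel_product[OF int_zp int_p] integrable_lborel_product[OF int_p int_zp]
    integrable_lborel_product[OF int_linear_p(1) int_linear_p(1)]
    integrable_lborel_product[OF int_linear_p(2) int_linear_p(2)]
  have h: "integrable (lborel \<Otimes>\<^sub>M lborel) h"
    unfolding h_def
    by (intro Bochner_Integration.integrable_diff Bochner_Integration.integrable_add integrable_mult_right q)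
  have Ih: "(\<integral>x. h x \<partial>(lborel \<Otimes>\<^sub>M lborel)) = S - (Qre\<^sup>2 + Qim\<^sup>2)"
    unfolding h_def
    apply (subst Bochner_Integration.integral_diff Bochner_Integration.integral_add,
        (intro Bochner_Integration.integrable_diff Bochner_Integration.integrable_add integrable_mult_right q)+)+
    apply (simp only: integral_mult_right_zero q mass_p S_def[symmetric] Qre_def[symmetric] Qim_def[symmetric])
    apply (simp add: power2_eq_square)
    done
  have "(cmod w)\<^sup>2 * K Z w = h (turn (Z, w))" for Z w
  proof -
    define x y where "x = (Z + w) / of_real (sqrt 2)" and "y = (Z - w) / of_real (sqrt 2)"
    have "x - y = of_real (sqrt 2) * w"
      by (simp add: x_def y_def field_simps flip: of_real_mult)
    then have "(cmod (x - y))\<^sup>2 = 2 * (cmod w)\<^sup>2"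
      by (simp add: norm_mult power_mult_distrib)
    then have w: "(cmod w)\<^sup>2 = 1 / 2 * (cmod x)\<^sup>2 + 1 / 2 * (cmod y)\<^sup>2 - Re x * Re y - Im x * Im y"
      unfolding cmod_power2 by (simp add: power2_eq_square algebra_simps)
    have "h (turn (Z, w)) = (1 / 2 * (cmod x)\<^sup>2 + 1 / 2 * (cmod y)\<^sup>2 - Re x * Re y - Im x * Im y) * (p x * p y)"
      by (simp add: h_def turn_def x_def[symmetric] y_def[symmetric] algebra_simps)
    then show ?thesis unfolding w[symmetric] by (simp add: K_def x_def y_def)
  qed
  then have wK: "(\<lambda>(Z, w). (cmod w)\<^sup>2 * K Z w) = (\<lambda>x. h (turn x))" by auto
  show "integrable (lborel \<Otimes>\<^sub>M lborel) (\<lambda>(Z, w). (cmod w)\<^sup>2 * K Z w)"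
    unfolding wK by (rule integrable_turn(1)[OF h])
  show "(\<integral>x. (case x of (Z, w) \<Rightarrow> (cmod w)\<^sup>2 * K Z w) \<partial>(lborel \<Otimes>\<^sub>M lborel)) = S - (Qre\<^sup>2 + Qim\<^sup>2)"
    unfolding wK integrable_turn(2)[OF h] Ih ..
qed

lemma AE_slice_integrable:
  "AE Z in lborel. integrable lborel (K Z) \<and> integrable lborel (\<lambda>w. (cmod w)\<^sup>2 * K Z w)"
  using lborel_pair.AE_integrable_fst'[OF K_integral(1)] lborel_pair.AE_integrable_fst'[OF weighted_K_integral(1)]
  by eventually_elim simp

section \<open>The diagonal \<open>w = 0\<close> and the quartic integral\<close>

lemma K_diag: "K Z 0 = (p (Z / of_real (sqrt 2)))\<^sup>2"
  by (simp add: K_def power2_eq_square)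

text \<open>The slice inequality
  \<open>pi * K Z 0 \<le> (\<integral>w. K Z w \<partial>lborel)\<close> dominates the diagonal by a
  function of \<open>Z\<close> that is integrable by Fubini.\<close>

lemma integrable_K_diag: "integrable lborel (\<lambda>Z. K Z 0)"
proof (rule Bochner_Integration.integrable_bound)
  show "integrable lborel (\<lambda>Z. \<integral>w. (case (Z, w) of (Z, w) \<Rightarrow> K Z w) \<partial>lborel)"
    by (rule lborel_pair.integrable_fst'[OF K_integral(1)])
  show "AE Z in lborel. norm (K Z 0) \<le> norm (\<integral>w. (case (Z, w) of (Z, w) \<Rightarrow> K Z w) \<partial>lborel)"
    using AE_slice_integrable
  proof eventually_elim
    fix Z assume "integrable lborel (K Z) \<and> integrable lborel (\<lambda>w. (cmod w)\<^sup>2 * K Z w)"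
    then have 1: "pi * K Z 0 \<le> (\<integral>w. K Z w \<partial>lborel)" using slice_deficit(3) by blast
    have 2: "K Z 0 \<ge> 0" by (simp add: K_diag)
    have "1 * K Z 0 \<le> pi * K Z 0" using pi_gt3 2 by (intro mult_right_mono) auto
    with 1 2 show "norm (K Z 0) \<le> norm (\<integral>w. (case (Z, w) of (Z, w) \<Rightarrow> K Z w) \<partial>lborel)" by simp
  qed
qed (simp add: K_diag)

lemma lborel_scale_sqrt2: "lborel = density (distr lborel borel (\<lambda>z::complex. z / of_real (sqrt 2))) (\<lambda>_. ennreal (1 / 2))"
proof -
  have "lborel = density (distr lborel borel (\<lambda>x::complex. 0 + (1 / sqrt 2) *\<^sub>R x)) (\<lambda>_. ennreal (\<bar>1 / sqrt 2\<bar> ^ DIM(complex)))"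
    by (rule lborel_affine) simp
  also have "(\<lambda>x::complex. 0 + (1 / sqrt 2) *\<^sub>R x) = (\<lambda>z. z / of_real (sqrt 2))"
    by (simp add: fun_eq_iff scaleR_conv_of_real)
  also have "\<bar>1 / sqrt 2\<bar> ^ DIM(complex) = 1 / 2"
    by (simp add: power_divide)
  finally show ?thesis .
qed

text \<open>Both claims transfer the diagonal through \<open>z = Z / sqrt 2\<close>; the factor 2 is
  the Jacobian of this scaling in real dimension two.\<close>

lemma
  shows integrable_p_sq: "integrable lborel (\<lambda>z. (p z)\<^sup>2)" and integral_K_diag: "(\<integral>Z. K Z 0 \<partial>lborel) = 2 * I4"
proof -
  have d: "(\<lambda>Z. K Z 0) = (\<lambda>Z. (p (Z / of_real (sqrt 2)))\<^sup>2)" by (simp add: K_diag[abs_def])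
  have T: "(\<lambda>z::complex. z / of_real (sqrt 2)) \<in> lborel \<rightarrow>\<^sub>M borel" by measurable
  have i: "integrable (distr lborel borel (\<lambda>z::complex. z / of_real (sqrt 2))) (\<lambda>z. (p z)\<^sup>2)"
    using integrable_K_diag unfolding d by (subst integrable_distr_eq[OF T]) simp_all
  show "integrable lborel (\<lambda>z. (p z)\<^sup>2)"
    by (subst lborel_scale_sqrt2, subst integrable_density) (use i in simp_all)
  have "I4 = (\<integral>z. (p z)\<^sup>2 \<partial>density (distr lborel borel (\<lambda>z::complex. z / of_real (sqrt 2))) (\<lambda>_. ennreal (1 / 2)))"
    by (simp only: I4_def lborel_scale_sqrt2[symmetric])
  also have "\<dots> = (\<integral>z. 1 / 2 * (p z)\<^sup>2 \<partial>distr lborel borel (\<lambda>z::complex. z / of_real (sqrt 2)))"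
    by (subst integral_density) simp_all
  also have "\<dots> = (\<integral>z. 1 / 2 * (p (z / of_real (sqrt 2)))\<^sup>2 \<partial>lborel)"
    by (rule integral_distr[OF T]) simp
  also have "\<dots> = 1 / 2 * (\<integral>Z. K Z 0 \<partial>lborel)" by (simp add: d)
  finally show "(\<integral>Z. K Z 0 \<partial>lborel) = 2 * I4" by simp
qed

section \<open>The integrated deficit: energy bound and equality case\<close>

lemma D_nonneg: "AE Z in lborel. D Z \<ge> 0"
  using AE_slice_integrable by eventually_elim (blast intro: slice_deficit(1))

lemma D_integral:
  shows "integrable lborel D" and "(\<integral>Z. D Z \<partial>lborel) = S - (Qre\<^sup>2 + Qim\<^sup>2) + 4 * pi * I4 - 3"
proof -
  note a = lborel_pair.integrable_fst'[OF K_integral(1), simplified]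
  note b = lborel_pair.integrable_fst'[OF weighted_K_integral(1), simplified]
  show "integrable lborel D" unfolding D_def[abs_def]
    by (intro Bochner_Integration.integrable_diff Bochner_Integration.integrable_add integrable_mult_right a b integrable_K_diag)
  have "(\<integral>Z. D Z \<partial>lborel) = (\<integral>Z. \<integral>w. (cmod w)\<^sup>2 * K Z w \<partial>lborel \<partial>lborel)
      + 2 * pi * (\<integral>Z. K Z 0 \<partial>lborel) - 3 * (\<integral>Z. \<integral>w. K Z w \<partial>lborel \<partial>lborel)"
    unfolding D_def using a b integrable_K_diag by simp
  also have "(\<integral>Z. \<integral>w. K Z w \<partial>lborel \<partial>lborel) = 1"
    using lborel_pair.integral_fst'[OF K_integral(1)] K_integral(2) by simp
  also have "(\<integral>Z. \<integral>w. (cmod w)\<^sup>2 * K Z w \<partial>lborel \<partial>lborel) = S - (Qre\<^sup>2 + Qim\<^sup>2)"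
    using lborel_pair.integral_fst'[OF weighted_K_integral(1)] weighted_K_integral(2) by simp
  finally show "(\<integral>Z. D Z \<partial>lborel) = S - (Qre\<^sup>2 + Qim\<^sup>2) + 4 * pi * I4 - 3"
    by (simp add: integral_K_diag)
qed

text \<open>The left side is the energy at \<open>mu = 1/2\<close>, see \<open>energy_eq\<close>;
  the identity is \<open>D_integral\<close> solved for it.\<close>

lemma energy_identity:
  "2 * pi * I4 + (S - 1) / 2 = 1 + (Qre\<^sup>2 + Qim\<^sup>2) / 2 + (\<integral>Z. D Z \<partial>lborel) / 2"
  unfolding D_integral(2) by (simp add: field_simps)

lemma energy_bound: "2 * pi * I4 + (S - 1) / 2 \<ge> 1 + (Qre\<^sup>2 + Qim\<^sup>2) / 2"
  using integral_nonneg_AE[OF D_nonneg] by (simp add: energy_identity)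

text \<open>After rescaling by \<open>sqrt 2\<close> the hypothesis says that every slice
  \<open>F Z\<close> is of the form \<open>A + w\<^sup>2 * B\<close>, which is the case of zero
  deficit.\<close>

lemma energy_equality:
  assumes "\<And>Z w. f (Z + w) * f (Z - w) = (f Z)\<^sup>2 + w\<^sup>2 * B Z"
  shows "2 * pi * I4 + (S - 1) / 2 = 1 + (Qre\<^sup>2 + Qim\<^sup>2) / 2"
proof -
  have F: "\<exists>A B. \<forall>w. F Z w = A + w\<^sup>2 * B" for Z
  proof -
    have "F Z w = (f (Z / of_real (sqrt 2)))\<^sup>2 + w\<^sup>2 * (B (Z / of_real (sqrt 2)) / 2)" for w
    proof -
      have "(w / of_real (sqrt 2))\<^sup>2 = w\<^sup>2 / 2"
        by (simp add: power_divide del: of_real_power flip: of_real_power)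
      then show ?thesis
        using assms[of "Z / of_real (sqrt 2)" "w / of_real (sqrt 2)"]
        by (simp add: F_def add_divide_distrib diff_divide_distrib)
    qed
    then show ?thesis by blast
  qed
  have "AE Z in lborel. D Z = 0"
    using AE_slice_integrable by eventually_elim (use slice_deficit(2) F in blast)
  then have "(\<integral>Z. D Z \<partial>lborel) = 0" by (rule integral_eq_zero_AE)
  then show ?thesis by (simp add: energy_identity)
qed

text \<open>At the minimum both nonnegative terms of \<open>energy_identity\<close> vanish. A
  nonnegative integrable \<open>D\<close> with integral 0 vanishes almost everywhere, which fixes
  the form of almost every slice.\<close>

lemma energy_minimal:
  assumes "2 * pi * I4 + (S - 1) / 2 \<le> 1"
  shows "Qre = 0" "Qim = 0" "\<exists>B. \<forall>Z w. f (Z + w) * f (Z - w) = (f Z)\<^sup>2 + w\<^sup>2 * B Z"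
proof -
  have nn: "(\<integral>Z. D Z \<partial>lborel) \<ge> 0" by (rule integral_nonneg_AE[OF D_nonneg])
  then have "Qre\<^sup>2 + Qim\<^sup>2 \<le> 0"
    using assms[unfolded energy_identity] by (simp add: add_divide_distrib[symmetric])
  then have Q: "Qre\<^sup>2 + Qim\<^sup>2 = 0" using sum_power2_ge_zero[of Qre Qim] by linarith
  then show "Qre = 0" "Qim = 0" by (auto simp: sum_power2_eq_zero_iff)
  have "(\<integral>Z. D Z \<partial>lborel) = 0" using nn assms[unfolded energy_identity] Q by simp
  then have "AE Z in lborel. D Z = 0"
    using integral_nonneg_eq_0_iff_AE[OF D_integral(1) D_nonneg] by simp
  \<comment> \<open>The unknown coefficients are replaced by values of \<open>F Z\<close> at
    \<open>w = 0\<close> and \<open>w = 1\<close>, so that both sides become continuous in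
    \<open>Z\<close>.\<close>
  with AE_slice_integrable have ae: "AE Z in lborel. \<forall>w. F Z w = F Z 0 + w\<^sup>2 * (F Z 1 - F Z 0)"
  proof eventually_elim
    case (elim Z)
    then obtain A B where "\<And>w. F Z w = A + w\<^sup>2 * B" using slice_deficit(2)[of Z] by auto
    then show ?case by simp
  qed
  \<comment> \<open>For fixed \<open>w\<close> the identity holds on a closed set of
    \<open>Z\<close> of full measure, and such a set is the whole plane.\<close>
  have all: "F Z w = F Z 0 + w\<^sup>2 * (F Z 1 - F Z 0)" for Z w
  proof -
    let ?N = "{Z. F Z w = F Z 0 + w\<^sup>2 * (F Z 1 - F Z 0)}"
    have c: "continuous_on UNIV (\<lambda>Z. F Z v)" for v
    proof -
      have "continuous_on UNIV (\<lambda>Z. f ((Z + v) / of_real (sqrt 2)))" for v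
        by (rule continuous_on_compose2[OF f_continuous]) (intro continuous_intros, auto)
      from continuous_on_mult[OF this[of v] this[of "- v"]] show ?thesis by (simp add: F_def)
    qed
    have cl: "closed ?N"
      by (intro closed_Collect_eq continuous_intros c)
    have "AE Z in lborel. Z \<in> ?N" using ae by (rule AE_mp) (rule AE_I2, blast)
    from mem_closed_if_AE_lebesgue[OF cl AE_completion[OF this]] have "Z \<in> ?N" .
    then show ?thesis by simp
  qed
  have eqn: "f (Z + w) * f (Z - w) = (f Z)\<^sup>2 + w\<^sup>2 * (2 * (F (Z * of_real (sqrt 2)) 1 - F (Z * of_real (sqrt 2)) 0))" for Z w
  proof -
    define r where "r = complex_of_real (sqrt 2)"
    have r: "r \<noteq> 0" "r\<^sup>2 = 2" by (simp_all add: r_def del: of_real_power flip: of_real_power)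
    have "(Z * r + w * r) / r = Z + w" "(Z * r - w * r) / r = Z - w"
      using r by (simp_all add: field_simps)
    then have "F (Z * r) (w * r) = f (Z + w) * f (Z - w)"
      by (simp only: F_def r_def[symmetric])
    moreover have "F (Z * r) 0 = (f Z)\<^sup>2"
      using r by (simp add: F_def r_def[symmetric] power2_eq_square)
    moreover have "(w * r)\<^sup>2 * x = w\<^sup>2 * (2 * x)" for x by (simp add: power_mult_distrib r)
    ultimately show ?thesis
      using all[of "Z * r" "w * r"] by (simp add: r_def[symmetric])
  qed
  show "\<exists>B. \<forall>Z w. f (Z + w) * f (Z - w) = (f Z)\<^sup>2 + w\<^sup>2 * B Z" by (intro exI allI) (rule eqn)
qed

end

subsection \<open>Minimizers\<close>

lemma gaussian_monomial_integral:
  "has_bochner_integral lborel (\<lambda>z. z ^ n * cnj z ^ m * of_real (exp (- (cmod z)\<^sup>2)))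
     (of_real (if n = m then pi * fact n else 0))"
proof -
  have mom: "integrable lborel (\<lambda>z. cmod z ^ (2 * k) * exp (- (cmod z)\<^sup>2))"
    "(\<integral>z. cmod z ^ (2 * k) * exp (- (cmod z)\<^sup>2) \<partial>lborel) = pi * fact k" for k
  proof -
    have "has_bochner_integral lborel (\<lambda>z. cmod z ^ (2 * k) * exp (- (cmod z)\<^sup>2)) (pi * fact k)"
      by (rule has_bochner_integral_nn_integral) (auto simp: nn_integral_gaussian_moment)
    then show "integrable lborel (\<lambda>z. cmod z ^ (2 * k) * exp (- (cmod z)\<^sup>2))"
      "(\<integral>z. cmod z ^ (2 * k) * exp (- (cmod z)\<^sup>2) \<partial>lborel) = pi * fact k"
      by (auto simp: has_bochner_integral_iff)
  qed
  have "integrable lborel (\<lambda>z. z ^ n * cnj z ^ m * of_real (exp (- (cmod z)\<^sup>2)))"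
  proof (rule Bochner_Integration.integrable_bound)
    show "integrable lborel (\<lambda>z. cmod z ^ (2 * n) * exp (- (cmod z)\<^sup>2) + cmod z ^ (2 * m) * exp (- (cmod z)\<^sup>2))"
      by (intro Bochner_Integration.integrable_add mom)
    show "AE z in lborel. norm (z ^ n * cnj z ^ m * of_real (exp (- (cmod z)\<^sup>2)))
        \<le> norm (cmod z ^ (2 * n) * exp (- (cmod z)\<^sup>2) + cmod z ^ (2 * m) * exp (- (cmod z)\<^sup>2))"
    proof (rule AE_I2)
      fix z :: complex
      have "x * y \<le> x\<^sup>2 + y\<^sup>2" if "x \<ge> 0" "y \<ge> 0" for x y :: real
        using sum_squares_bound[of x y] mult_nonneg_nonneg[OF that] by linarith
      from this[of "cmod z ^ n" "cmod z ^ m"]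
      have "cmod z ^ n * cmod z ^ m \<le> cmod z ^ (2 * n) + cmod z ^ (2 * m)"
        by (simp add: power_mult[symmetric] mult.commute)
      then have "cmod z ^ n * cmod z ^ m * exp (- (cmod z)\<^sup>2) \<le> (cmod z ^ (2 * n) + cmod z ^ (2 * m)) * exp (- (cmod z)\<^sup>2)"
        by (rule mult_right_mono) simp
      then show "norm (z ^ n * cnj z ^ m * of_real (exp (- (cmod z)\<^sup>2)))
        \<le> norm (cmod z ^ (2 * n) * exp (- (cmod z)\<^sup>2) + cmod z ^ (2 * m) * exp (- (cmod z)\<^sup>2))"
        by (simp add: norm_mult norm_power algebra_simps)
    qed
  qed simp
  moreover have "(\<integral>z. z ^ n * cnj z ^ m * of_real (exp (- (cmod z)\<^sup>2)) \<partial>lborel)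
      = of_real (if n = m then pi * fact n else 0)"
  proof (cases "n = m")
    case False
    then show ?thesis using integral_monomials_orthogonal[of "\<lambda>r. exp (- r\<^sup>2)" n m] by simp
  next
    case True
    have "z ^ n * cnj z ^ n * of_real (exp (- (cmod z)\<^sup>2)) = complex_of_real (cmod z ^ (2 * n) * exp (- (cmod z)\<^sup>2))" for z
      by (simp add: power_mult power_mult_distrib[symmetric] flip: complex_norm_square)
    then have "(\<integral>z. z ^ n * cnj z ^ n * of_real (exp (- (cmod z)\<^sup>2)) \<partial>lborel) = of_real (pi * fact n)"
      by (simp only: integral_complex_of_real mom)
    with True show ?thesis by simp
  qed
  ultimately show ?thesis by (simp only: has_bochner_integral_iff)
qed

lemma has_bochner_integral_lborel_translate:
  fixes h :: "complex \<Rightarrow> 'b::{banach, second_countable_topology}"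
  assumes m: "h \<in> borel_measurable borel" and b: "has_bochner_integral lborel (\<lambda>y. h (t + y)) x"
  shows "has_bochner_integral lborel h x"
proof -
  have "has_bochner_integral (distr lborel borel ((+) t)) h x"
    by (rule has_bochner_integral_distr[OF m _ b]) simp
  then show ?thesis by (simp add: lborel_distr_plus)
qed

text \<open>Completing the square, \<open>- |z|^2 + 2 * Re (a * z) = |a|^2 - |z - cnj a|^2\<close>:
  the density is a Gaussian centred at \<open>cnj a\<close>, and with \<open>z = cnj a + y\<close>
  the polynomial becomes \<open>\<gamma> + \<beta> * y\<close>. All integrals reduce to centred
  moments, whose mixed ones vanish.\<close>

lemma affine_gaussian_integrals:
  fixes \<alpha> \<beta> a :: complex
  defines "q \<equiv> (\<lambda>z. (cmod (of_real (exp (- (norm z)\<^sup>2 / 2)) * ((\<alpha> + \<beta> * z) * exp (a * z))))\<^sup>2)"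
  defines "\<gamma> \<equiv> \<alpha> + \<beta> * cnj a"
  defines "N \<equiv> pi * exp ((cmod a)\<^sup>2)"
  shows "integrable lborel q" and "integrable lborel (\<lambda>z. (cmod z)\<^sup>2 * q z)"
    and "integral\<^sup>L lborel q = N * ((cmod \<gamma>)\<^sup>2 + (cmod \<beta>)\<^sup>2)"
    and "Complex (\<integral>z. Re z * q z \<partial>lborel) (\<integral>z. Im z * q z \<partial>lborel)
      = of_real N * (\<gamma> * cnj \<beta> + cnj a * of_real ((cmod \<gamma>)\<^sup>2 + (cmod \<beta>)\<^sup>2))"
proof -
  have qm [measurable]: "q \<in> borel_measurable borel"
    unfolding q_def by (intro borel_measurable_continuous_onI continuous_intros) auto
  have q: "q (cnj a + y) = exp ((cmod a)\<^sup>2) * (cmod (\<gamma> + \<beta> * y))\<^sup>2 * exp (- (cmod y)\<^sup>2)" for y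
  proof -
    let ?z = "cnj a + y"
    have *: "(exp (x / 2))\<^sup>2 = exp x" for x :: real
      by (simp add: power2_eq_square flip: exp_add)
    have "(cmod (exp (a * ?z)))\<^sup>2 = exp (2 * Re (a * ?z))"
      by (simp only: norm_exp_eq_Re power2_eq_square exp_add[symmetric] mult_2)
    then have "q ?z = exp (- (cmod ?z)\<^sup>2) * (cmod (\<alpha> + \<beta> * ?z))\<^sup>2 * exp (2 * Re (a * ?z))"
      using *[of "- (cmod ?z)\<^sup>2"] unfolding q_def norm_mult power_mult_distrib by simp
    also have "\<dots> = exp (- (cmod ?z)\<^sup>2 + 2 * Re (a * ?z)) * (cmod (\<alpha> + \<beta> * ?z))\<^sup>2"
      unfolding exp_add by (simp add: mult.commute mult.left_commute)
    also have "- (cmod ?z)\<^sup>2 + 2 * Re (a * ?z) = (cmod a)\<^sup>2 + - (cmod y)\<^sup>2"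
      unfolding cmod_power2 by (simp add: power2_eq_square algebra_simps)
    also have "\<alpha> + \<beta> * ?z = \<gamma> + \<beta> * y" by (simp add: \<gamma>_def algebra_simps)
    finally show ?thesis unfolding exp_add by simp
  qed
  define G where "G i j = complex_of_real (if i = j then pi * fact i else 0)" for i j :: nat
  define E where "E = complex_of_real (exp ((cmod a)\<^sup>2))"
  \<comment> \<open>The moment of \<open>y^i * cnj y^j\<close> against the shifted density, from the
    four terms of the square of \<open>\<gamma> + \<beta> * y\<close>.\<close>
  define T where "T i j = E * (\<gamma> * cnj \<gamma> * G i j + \<gamma> * cnj \<beta> * G i (Suc j) + \<beta> * cnj \<gamma> * G (Suc i) j
      + \<beta> * cnj \<beta> * G (Suc i) (Suc j))" for i j
  have T: "has_bochner_integral lborel (\<lambda>y. y ^ i * cnj y ^ j * of_real (q (cnj a + y))) (T i j)" for i j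
  proof -
    let ?m = "\<lambda>i j y. y ^ i * cnj y ^ j * complex_of_real (exp (- (cmod y)\<^sup>2))"
    have e: "y ^ i * cnj y ^ j * of_real (q (cnj a + y)) = E * (\<gamma> * cnj \<gamma> * ?m i j y + \<gamma> * cnj \<beta> * ?m i (Suc j) y
        + \<beta> * cnj \<gamma> * ?m (Suc i) j y + \<beta> * cnj \<beta> * ?m (Suc i) (Suc j) y)" for y
    proof -
      have "complex_of_real (q (cnj a + y))
          = E * ((\<gamma> + \<beta> * y) * cnj (\<gamma> + \<beta> * y)) * of_real (exp (- (cmod y)\<^sup>2))"
        unfolding q of_real_mult complex_norm_square E_def ..
      then show ?thesis by (simp add: algebra_simps)
    qed
    show ?thesis unfolding e T_def G_def
      by (intro has_bochner_integral_mult_right has_bochner_integral_add gaussian_monomial_integral)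
  qed
  have mom: "G 0 0 = of_real pi" "G (Suc 0) (Suc 0) = of_real pi" "G 0 (Suc 0) = 0" "G (Suc 0) 0 = 0"
    "G (Suc (Suc 0)) 0 = 0" "G (Suc (Suc 0)) (Suc 0) = 0"
    by (simp_all add: G_def)
  define W where "W = N * ((cmod \<gamma>)\<^sup>2 + (cmod \<beta>)\<^sup>2)"
  have T00: "T 0 0 = of_real W"
    unfolding T_def mom W_def N_def E_def of_real_mult of_real_add complex_norm_square by (simp add: algebra_simps)
  have T10: "T 1 0 = of_real N * (\<gamma> * cnj \<beta>)"
    by (simp add: T_def mom N_def E_def)
  have b0: "has_bochner_integral lborel (\<lambda>y. complex_of_real (q (cnj a + y))) (of_real W)"
    using T[of 0 0] T00 by simp
  have B0: "has_bochner_integral lborel (\<lambda>z. complex_of_real (q z)) (of_real W)"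
    by (rule has_bochner_integral_lborel_translate[OF _ b0]) simp
  show "integrable lborel q"
    using integrable_Re[OF integrable.intros[OF B0]] by simp
  show "integral\<^sup>L lborel q = N * ((cmod \<gamma>)\<^sup>2 + (cmod \<beta>)\<^sup>2)"
    using has_bochner_integral_integral_eq[OF B0] by (simp add: W_def[symmetric] del: of_real_mult of_real_add)
  have scale: "has_bochner_integral lborel (\<lambda>y. c * h y) (c * x)"
    if "has_bochner_integral lborel h x" for c x and h :: "complex \<Rightarrow> complex"
    using that by (rule has_bochner_integral_mult_right)
  have b1: "has_bochner_integral lborel (\<lambda>y. (cnj a + y) * complex_of_real (q (cnj a + y)))
      (cnj a * of_real W + T 1 0)"
    using has_bochner_integral_add[OF scale[OF b0, of "cnj a"] T[of 1 0]]
    by (simp add: algebra_simps)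
  have B1: "has_bochner_integral lborel (\<lambda>z. z * complex_of_real (q z)) (cnj a * of_real W + T 1 0)"
    by (rule has_bochner_integral_lborel_translate[OF _ b1]) simp
  have "has_bochner_integral lborel (\<lambda>y. ((cnj a + y) * cnj (cnj a + y)) * complex_of_real (q (cnj a + y)))
      (cnj a * a * of_real W + cnj a * T 0 1 + a * T 1 0 + T 1 1)"
    using has_bochner_integral_add[OF has_bochner_integral_add[OF has_bochner_integral_add[OF
        scale[OF b0, of "cnj a * a"] scale[OF T[of 0 1], of "cnj a"]]
        scale[OF T[of 1 0], of a]] T[of 1 1]]
    by (simp add: algebra_simps)
  then have B2: "has_bochner_integral lborel (\<lambda>z. (z * cnj z) * complex_of_real (q z))
      (cnj a * a * of_real W + cnj a * T 0 1 + a * T 1 0 + T 1 1)"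
    by (rule has_bochner_integral_lborel_translate[rotated]) simp
  show "integrable lborel (\<lambda>z. (cmod z)\<^sup>2 * q z)"
    using integrable_Re[OF integrable.intros[OF B2]] unfolding cmod_power2 by (simp add: power2_eq_square)
  have "integrable lborel (\<lambda>z. z * complex_of_real (q z))"
    by (rule integrable.intros[OF B1])
  from integral_Re[OF this] integral_Im[OF this]
  have "Complex (\<integral>z. Re z * q z \<partial>lborel) (\<integral>z. Im z * q z \<partial>lborel) = (\<integral>z. z * complex_of_real (q z) \<partial>lborel)"
    by (simp add: complex_eq_iff)
  also have "\<dots> = cnj a * of_real W + T 1 0"
    by (rule has_bochner_integral_integral_eq[OF B1])
  also have "\<dots> = of_real N * (\<gamma> * cnj \<beta> + cnj a * of_real ((cmod \<gamma>)\<^sup>2 + (cmod \<beta>)\<^sup>2))"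
    unfolding T10 W_def by (simp add: algebra_simps)
  finally show "Complex (\<integral>z. Re z * q z \<partial>lborel) (\<integral>z. Im z * q z \<partial>lborel)
      = of_real N * (\<gamma> * cnj \<beta> + cnj a * of_real ((cmod \<gamma>)\<^sup>2 + (cmod \<beta>)\<^sup>2))" .
qed

section \<open>The extended-real energy\<close>

lemma ext_integral_eq:
  assumes "integrable lborel g"
  shows "ext_integral g = ereal (\<integral>z. g z \<partial>lborel)"
proof -
  have fin: "(\<integral>\<^sup>+z. ennreal (g z) \<partial>lborel) < top" "(\<integral>\<^sup>+z. ennreal (- g z) \<partial>lborel) < top"
    using assms by (auto simp: real_integrable_def less_top)
  then obtain a b where ab: "(\<integral>\<^sup>+z. ennreal (g z) \<partial>lborel) = ennreal a" "a \<ge> 0"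
    "(\<integral>\<^sup>+z. ennreal (- g z) \<partial>lborel) = ennreal b" "b \<ge> 0"
    by (auto simp: less_top_ennreal)
  show ?thesis
    unfolding ext_integral_def real_lebesgue_integral_def[OF assms] ab by (simp add: ab)
qed

context fock_state begin

lemma mass_eq_1: "mass u = 1"
  using mass by (simp add: mass_def)

lemma in_bargmann_fock: "u \<in> bargmann_fock"
proof -
  have "continuous_on UNIV u"
    unfolding u_eq by (intro continuous_intros f_continuous) auto
  then have "u \<in> borel_measurable lborel"
    by (simp add: borel_measurable_continuous_onI)
  then show ?thesis
    using hol u_eq int0 by (auto simp: bargmann_fock_def square_integrable_def)
qed

lemma energy_eq: "energy_G (1/2) u = ereal (2 * pi * I4 + (S - 1) / 2)"
proof -
  have "(cmod (u z)) ^ 4 = (p z)\<^sup>2" for z by (simp add: p_def flip: power_mult)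
  then have h: "hamiltonian u = ereal (I4 / 4)"
    using integrable_p_sq by (simp add: hamiltonian_def ext_integral_eq I4_def)
  have "((cmod z)\<^sup>2 - 1) * (cmod (u z))\<^sup>2 = (cmod z)\<^sup>2 * p z - p z" for z
    by (simp add: p_def algebra_simps)
  then have "angular_P u = ereal (S - 1)"
    using int_zp int_p by (simp add: angular_P_def ext_integral_eq S_def mass_p)
  with h show ?thesis by (simp add: energy_G_def)
qed

lemma energy_ge_1: "energy_G (1/2) u \<ge> 1"
proof -
  have "(Qre\<^sup>2 + Qim\<^sup>2) / 2 \<ge> 0" by simp
  then have "2 * pi * I4 + (S - 1) / 2 \<ge> 1" using energy_bound by (meson add_increasing2 order_trans order_refl)
  then show ?thesis by (simp add: energy_eq one_ereal_def)
qed

end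

text \<open>The negative part of \<open>(|z|^2 - 1) * |u|^2\<close> is at most \<open>|u|^2\<close>,
  hence integrable. So an infinite second moment can only come from the positive part, and it makes
  the energy infinite.\<close>

lemma fock_state_of_finite_energy:
  assumes u: "u \<in> bargmann_fock" and m: "mass u = 1" and fin: "energy_G (1/2) u \<noteq> \<infinity>"
  shows "\<exists>f. fock_state f u"
proof -
  obtain f where f: "f holomorphic_on UNIV"
    "u = (\<lambda>z. complex_of_real (exp (- (norm z)\<^sup>2 / 2)) * f z)"
    and um: "u \<in> borel_measurable lborel" and int0: "integrable lborel (\<lambda>z. (cmod (u z))\<^sup>2)"
    using u by (auto simp: bargmann_fock_def square_integrable_def)
  have [measurable]: "u \<in> borel_measurable borel" using um by simp
  define g where "g z = ((cmod z)\<^sup>2 - 1) * (cmod (u z))\<^sup>2" for z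
  have [measurable]: "g \<in> borel_measurable borel" unfolding g_def by measurable
  have neg: "(\<integral>\<^sup>+z. ennreal (- g z) \<partial>lborel) < top"
  proof -
    have "(\<integral>\<^sup>+z. ennreal (- g z) \<partial>lborel) \<le> (\<integral>\<^sup>+z. ennreal ((cmod (u z))\<^sup>2) \<partial>lborel)"
      by (intro nn_integral_mono ennreal_leI) (simp add: g_def algebra_simps)
    also have "\<dots> < top"
      using int0 by (simp add: nn_integral_eq_integral)
    finally show ?thesis .
  qed
  have pos: "(\<integral>\<^sup>+z. ennreal (g z) \<partial>lborel) < top"
  proof (rule ccontr)
    assume "\<not> (\<integral>\<^sup>+z. ennreal (g z) \<partial>lborel) < top"
    then have "(\<integral>\<^sup>+z. ennreal (g z) \<partial>lborel) = top" by (simp flip: less_top)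
    moreover obtain b where "(\<integral>\<^sup>+z. ennreal (- g z) \<partial>lborel) = ennreal b" "b \<ge> 0"
      using neg by (auto simp: less_top_ennreal)
    ultimately have P: "angular_P u = \<infinity>"
      by (simp add: angular_P_def ext_integral_def g_def[symmetric])
    \<comment> \<open>Nonnegativity of the quartic term suffices: adding it to infinity gives
      infinity, whether or not it is finite.\<close>
    have "ext_integral (\<lambda>z. (cmod (u z)) ^ 4) \<ge> 0"
      by (simp add: ext_integral_def ennreal_neg zero_ennreal.rep_eq)
    then have "ereal (8 * pi) * hamiltonian u \<ge> 0"
      by (simp add: hamiltonian_def)
    then have "energy_G (1/2) u = \<infinity>"
      by (simp add: energy_G_def P)
    with fin show False by simp
  qed
  have "integrable lborel g"
    using neg pos by (simp add: real_integrable_def less_top)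
  then have "integrable lborel (\<lambda>z. g z + (cmod (u z))\<^sup>2)"
    using int0 by (rule Bochner_Integration.integrable_add)
  then have "integrable lborel (\<lambda>z. (cmod z)\<^sup>2 * (cmod (u z))\<^sup>2)"
    by (simp add: g_def algebra_simps)
  then show ?thesis
    using f int0 m by (auto simp: fock_state_def mass_def)
qed

lemma energy_ge_1:
  assumes "u \<in> bargmann_fock" "mass u = 1"
  shows "energy_G (1/2) u \<ge> 1"
  using fock_state_of_finite_energy[OF assms] fock_state.energy_ge_1 by fastforce

section \<open>Minimizers as affine functions times exponentials\<close>

text \<open>\<open>M\<close> is the mass condition. \<open>Q\<close> is the vanishing of the first
  moment, simplified by \<open>M\<close>. The functional equation holds because \<open>exp\<close>
  is multiplicative and the affine factors form a difference of squares.\<close>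

lemma affine_minimizer:
  fixes \<alpha> \<beta> a :: complex
  defines "\<gamma> \<equiv> \<alpha> + \<beta> * cnj a"
  assumes M: "pi * exp ((cmod a)\<^sup>2) * ((cmod \<gamma>)\<^sup>2 + (cmod \<beta>)\<^sup>2) = 1"
    and Q: "of_real (pi * exp ((cmod a)\<^sup>2)) * (\<gamma> * cnj \<beta>) + cnj a = 0"
  defines "u \<equiv> (\<lambda>z. complex_of_real (exp (- (norm z)\<^sup>2 / 2)) * ((\<alpha> + \<beta> * z) * exp (a * z)))"
  shows "u \<in> bargmann_fock \<and> mass u = 1 \<and> energy_G (1/2) u = 1"
proof -
  let ?f = "\<lambda>z. (\<alpha> + \<beta> * z) * exp (a * z)"
  let ?N = "pi * exp ((cmod a)\<^sup>2)"
  note ag = affine_gaussian_integrals[of \<alpha> \<beta> a, folded \<gamma>_def]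
  interpret fock_state ?f u
  proof
    show "?f holomorphic_on UNIV" by (intro holomorphic_intros)
    show "u = (\<lambda>z. complex_of_real (exp (- (norm z)\<^sup>2 / 2)) * ?f z)" by (simp add: u_def)
    show "integrable lborel (\<lambda>z. (cmod (u z))\<^sup>2)" unfolding u_def by (rule ag(1))
    show "integrable lborel (\<lambda>z. (cmod z)\<^sup>2 * (cmod (u z))\<^sup>2)" unfolding u_def by (rule ag(2))
    show "(\<integral>z. (cmod (u z))\<^sup>2 \<partial>lborel) = 1" unfolding u_def ag(3) by (rule M)
  qed
  have pf: "p = (\<lambda>z. (cmod (of_real (exp (- (norm z)\<^sup>2 / 2)) * ?f z))\<^sup>2)"
    by (rule ext, simp only: p_def, simp only: u_def)
  have "Complex Qre Qim = of_real ?N * (\<gamma> * cnj \<beta> + cnj a * of_real ((cmod \<gamma>)\<^sup>2 + (cmod \<beta>)\<^sup>2))"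
    unfolding Qre_def Qim_def pf by (rule ag(4))
  also have "\<dots> = of_real ?N * (\<gamma> * cnj \<beta>) + cnj a * of_real (?N * ((cmod \<gamma>)\<^sup>2 + (cmod \<beta>)\<^sup>2))"
    by (simp add: algebra_simps)
  also have "\<dots> = 0" unfolding M using Q by simp
  finally have Q0: "Qre = 0" "Qim = 0" by (auto simp: complex_eq_iff)
  have "?f (Z + w) * ?f (Z - w) = (?f Z)\<^sup>2 + w\<^sup>2 * (- (\<beta>\<^sup>2 * exp (2 * (a * Z))))" for Z w
  proof -
    have e: "exp (a * (Z + w)) * exp (a * (Z - w)) = exp (2 * (a * Z))"
      "exp (a * Z) * exp (a * Z) = exp (2 * (a * Z))"
      by (simp_all add: exp_add[symmetric] algebra_simps)
    have "?f (Z + w) * ?f (Z - w) = ((\<alpha> + \<beta> * (Z + w)) * (\<alpha> + \<beta> * (Z - w))) * (exp (a * (Z + w)) * exp (a * (Z - w)))"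
      by (simp only: mult_ac)
    also have "\<dots> = ((\<alpha> + \<beta> * Z)\<^sup>2 - \<beta>\<^sup>2 * w\<^sup>2) * exp (2 * (a * Z))"
      unfolding e by (simp add: power2_eq_square algebra_simps)
    also have "\<dots> = (\<alpha> + \<beta> * Z)\<^sup>2 * (exp (a * Z) * exp (a * Z)) + w\<^sup>2 * (- (\<beta>\<^sup>2 * exp (2 * (a * Z))))"
      unfolding e by (simp add: algebra_simps)
    finally show ?thesis by (simp add: power2_eq_square mult_ac)
  qed
  from energy_equality[OF this] Q0 have "2 * pi * I4 + (S - 1) / 2 = 1" by simp
  then show ?thesis
    using in_bargmann_fock mass_eq_1 energy_eq by (simp add: one_ereal_def)
qed

text \<open>Converse to \<open>affine_minimizer\<close>: the equality case yields the functional
  equation, the mass rules out \<open>f = 0\<close>, and the two conditions are read off the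
  explicit integrals.\<close>

lemma minimizer_affine:
  assumes "u \<in> bargmann_fock" "mass u = 1" "energy_G (1/2) u \<le> 1"
  obtains \<alpha> \<beta> a \<gamma> where "u = (\<lambda>z. complex_of_real (exp (- (norm z)\<^sup>2 / 2)) * ((\<alpha> + \<beta> * z) * exp (a * z)))"
    and "\<gamma> = \<alpha> + \<beta> * cnj a"
    and "pi * exp ((cmod a)\<^sup>2) * ((cmod \<gamma>)\<^sup>2 + (cmod \<beta>)\<^sup>2) = 1"
    and "of_real (pi * exp ((cmod a)\<^sup>2)) * (\<gamma> * cnj \<beta>) + cnj a = 0"
proof -
  obtain f where "fock_state f u"
    using fock_state_of_finite_energy[OF assms(1,2)] assms(3) by fastforce
  then interpret fock_state f u .
  have le: "2 * pi * I4 + (S - 1) / 2 \<le> 1"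
    using assms(3) by (simp add: energy_eq one_ereal_def)
  obtain B where B: "\<And>Z w. f (Z + w) * f (Z - w) = (f Z)\<^sup>2 + w\<^sup>2 * B Z"
    using energy_minimal(3)[OF le] by blast
  have "\<exists>z0. f z0 \<noteq> 0"
  proof (rule ccontr)
    assume "\<not> (\<exists>z0. f z0 \<noteq> 0)"
    then have "p = (\<lambda>_. 0)" by (auto simp: p_eq)
    then show False using mass_p by simp
  qed
  then obtain z0 where "f z0 \<noteq> 0" by blast
  from entire_quadratic_product[OF hol this B]
  obtain c a where "f = (\<lambda>z. c * exp (a * z)) \<or> (\<exists>p. f = (\<lambda>z. c * (z - p) * exp (a * z)))" by blast
  then have "\<exists>\<alpha> \<beta>. f = (\<lambda>z. (\<alpha> + \<beta> * z) * exp (a * z))"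
  proof (elim disjE exE)
    assume "f = (\<lambda>z. c * exp (a * z))"
    then show ?thesis by (intro exI[of _ c] exI[of _ 0]) simp
  next
    fix p assume "f = (\<lambda>z. c * (z - p) * exp (a * z))"
    then show ?thesis by (intro exI[of _ "- c * p"] exI[of _ c]) (simp add: algebra_simps)
  qed
  then obtain \<alpha> \<beta> where f: "f = (\<lambda>z. (\<alpha> + \<beta> * z) * exp (a * z))" by blast
  define \<gamma> where "\<gamma> = \<alpha> + \<beta> * cnj a"
  let ?N = "pi * exp ((cmod a)\<^sup>2)"
  note ag = affine_gaussian_integrals[of \<alpha> \<beta> a, folded \<gamma>_def]
  have pf: "p = (\<lambda>z. (cmod (of_real (exp (- (norm z)\<^sup>2 / 2)) * ((\<alpha> + \<beta> * z) * exp (a * z))))\<^sup>2)"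
    unfolding p_def[abs_def] by (simp add: u_eq f)
  have M: "?N * ((cmod \<gamma>)\<^sup>2 + (cmod \<beta>)\<^sup>2) = 1"
    using mass_p ag(3) unfolding pf by simp
  have "Complex Qre Qim = of_real ?N * (\<gamma> * cnj \<beta> + cnj a * of_real ((cmod \<gamma>)\<^sup>2 + (cmod \<beta>)\<^sup>2))"
    unfolding Qre_def Qim_def pf by (rule ag(4))
  also have "\<dots> = of_real ?N * (\<gamma> * cnj \<beta>) + cnj a * of_real (?N * ((cmod \<gamma>)\<^sup>2 + (cmod \<beta>)\<^sup>2))"
    by (simp add: algebra_simps)
  finally have Q: "of_real ?N * (\<gamma> * cnj \<beta>) + cnj a = 0"
    unfolding M using energy_minimal(1,2)[OF le] by (simp add: complex_eq_iff)
  show thesis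
    by (rule that[of \<alpha> \<beta> a \<gamma>]) (use u_eq f \<gamma>_def M Q in auto)
qed

section \<open>The parameter \<open>b\<close> and the classification up to rotations\<close>

text \<open>The modulus of \<open>a\<close> forced by zero first moment. If the zero of
  \<open>f\<close> has distance \<open>b\<close> from the centre \<open>cnj a\<close>, then
  \<open>|\<gamma>| = b * |\<beta>|\<close>; unit mass gives
  \<open>pi * exp (|a|^2) * |\<beta>|^2 = 1 / (1 + b^2)\<close>, and the moment condition gives
  \<open>|a| = b / (1 + b^2)\<close>.\<close>

definition psi_rate :: "real \<Rightarrow> real" where
  "psi_rate b = b / (1 + b\<^sup>2)"

definition psi_scale :: "real \<Rightarrow> real" where
  "psi_scale b = exp (- (1/2) * (psi_rate b)\<^sup>2) / sqrt (pi * (1 + b\<^sup>2))"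

lemma psi_scale_pos: "psi_scale b > 0"
  by (simp add: psi_scale_def add_pos_nonneg)

lemma psi_normalization: "pi * exp ((psi_rate b)\<^sup>2) * (psi_scale b)\<^sup>2 = 1 / (1 + b\<^sup>2)"
proof -
  define A where "A = psi_rate b"
  have b: "1 + b\<^sup>2 > 0" by (simp add: add_pos_nonneg)
  have "(exp (- (1/2) * A\<^sup>2))\<^sup>2 = exp (- A\<^sup>2)"
    by (simp add: power2_eq_square[of "exp _"] flip: exp_add)
  then have "(psi_scale b)\<^sup>2 = exp (- A\<^sup>2) / (pi * (1 + b\<^sup>2))"
    using b by (simp add: psi_scale_def A_def power_divide)
  then have "pi * exp (A\<^sup>2) * (psi_scale b)\<^sup>2 = (exp (A\<^sup>2) * exp (- A\<^sup>2)) * (pi / (pi * (1 + b\<^sup>2)))" by simp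
  also have "exp (A\<^sup>2) * exp (- A\<^sup>2) = 1" by (simp flip: exp_add)
  finally show ?thesis by (simp add: A_def)
qed

text \<open>Splitting the zero as \<open>b + psi_rate b\<close> shows its geometric meaning: it lies
  at distance \<open>b\<close> from the Gaussian centre \<open>psi_rate b\<close>.\<close>

lemma psi_eq:
  "psi b z = of_real (psi_scale b) * (z - of_real (b + psi_rate b))
    * exp (of_real (psi_rate b) * z - of_real ((norm z)\<^sup>2 / 2))"
proof -
  have "1 + b\<^sup>2 \<noteq> 0" by (metis add_pos_nonneg less_numeral_extra(1) less_irrefl zero_le_power2)
  then have P: "b * (2 + b\<^sup>2) / (1 + b\<^sup>2) = b + psi_rate b"
    by (simp add: psi_rate_def field_simps)
  show ?thesis
    unfolding psi_def P psi_scale_def psi_rate_def[symmetric] ..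
qed

lemma psi_rotated:
  fixes b g t :: real
  defines "A \<equiv> psi_rate b" and "C \<equiv> psi_scale b"
  shows "phase_rotation g (space_rotation t (psi b))
    = (\<lambda>z. complex_of_real (exp (- (norm z)\<^sup>2 / 2))
        * ((- (cis g * of_real C * of_real (b + A)) + (cis g * of_real C * cis t) * z) * exp (of_real A * cis t * z)))"
proof
  fix z :: complex
  have "exp (of_real A * (cis t * z) - of_real ((cmod z)\<^sup>2 / 2))
      = exp (of_real A * cis t * z) * complex_of_real (exp (- (norm z)\<^sup>2 / 2))"
    unfolding exp_of_real[symmetric] exp_add[symmetric] by (rule arg_cong[where f = exp]) simp
  then show "phase_rotation g (space_rotation t (psi b)) z
    = complex_of_real (exp (- (norm z)\<^sup>2 / 2))
        * ((- (cis g * of_real C * of_real (b + A)) + (cis g * of_real C * cis t) * z) * exp (of_real A * cis t * z))"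
    unfolding phase_rotation_def space_rotation_def psi_eq cis_conv_exp[symmetric]
      norm_mult norm_cis mult_1_left A_def[symmetric] C_def[symmetric]
    by (simp add: algebra_simps)
qed

text \<open>The vanishing coefficients are written out so that the right side matches the pattern of
  \<open>affine_minimizer\<close> with \<open>\<beta> = 0\<close> and \<open>a = 0\<close>.\<close>

lemma phi0_rotated:
  "phase_rotation g (space_rotation t phi0)
    = (\<lambda>z. complex_of_real (exp (- (norm z)\<^sup>2 / 2)) * ((cis g * of_real (1 / sqrt pi) + 0 * z) * exp (0 * z)))"
  by (simp add: fun_eq_iff phase_rotation_def space_rotation_def phi0_def cis_conv_exp[symmetric] norm_mult
      exp_of_real[symmetric])

lemma phi1_eq_psi: "phi1 = psi 0"
  by (simp add: fun_eq_iff phi1_def psi_def mult.assoc)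

lemma phi0_minimizer:
  fixes g t :: real
  defines "u \<equiv> phase_rotation g (space_rotation t phi0)"
  shows "u \<in> bargmann_fock \<and> mass u = 1 \<and> energy_G (1/2) u = 1"
  unfolding u_def phi0_rotated
  by (rule affine_minimizer) (simp_all add: norm_mult norm_divide power_divide)

text \<open>Passing to the centre \<open>cnj a\<close> turns the zero \<open>b + A\<close> into
  \<open>b\<close>. The mass condition is then \<open>psi_normalization\<close>, and the
  first-moment condition is the definition of \<open>psi_rate\<close>.\<close>

lemma psi_minimizer:
  fixes g t b :: real
  defines "u \<equiv> phase_rotation g (space_rotation t (psi b))"
  shows "u \<in> bargmann_fock \<and> mass u = 1 \<and> energy_G (1/2) u = 1"
proof -
  define A where "A = psi_rate b"
  define C where "C = psi_scale b"
  have n: "pi * exp (A\<^sup>2) * C\<^sup>2 = 1 / (1 + b\<^sup>2)" unfolding A_def C_def by (rule psi_normalization)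
  have b: "1 + b\<^sup>2 > 0" by (simp add: add_pos_nonneg)
  have cc: "cis x * cnj (cis x) = 1" for x by (simp add: cis_cnj cis_mult)
  let ?\<alpha> = "- (cis g * of_real C * of_real (b + A))" and ?\<beta> = "cis g * of_real C * cis t"
    and ?a = "of_real A * cis t"
  have a: "(cmod ?a)\<^sup>2 = A\<^sup>2" by (simp add: norm_mult)
  have "?\<alpha> + ?\<beta> * cnj ?a = - (cis g * of_real C * of_real (b + A)) + cis g * of_real C * of_real A * (cis t * cnj (cis t))"
    by simp
  then have \<gamma>: "?\<alpha> + ?\<beta> * cnj ?a = - (cis g * of_real C * of_real b)"
    unfolding cc by (simp add: algebra_simps)
  have "pi * exp (A\<^sup>2) * ((cmod (- (cis g * of_real C * of_real b)))\<^sup>2 + (cmod ?\<beta>)\<^sup>2)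
      = (pi * exp (A\<^sup>2) * C\<^sup>2) * (1 + b\<^sup>2)"
    by (simp add: norm_mult power_mult_distrib algebra_simps)
  then have M: "pi * exp (A\<^sup>2) * ((cmod (- (cis g * of_real C * of_real b)))\<^sup>2 + (cmod ?\<beta>)\<^sup>2) = 1"
    unfolding n using b by simp
  have "- (cis g * of_real C * of_real b) * cnj ?\<beta> = - (of_real (C\<^sup>2 * b) * cnj (cis t)) * (cis g * cnj (cis g))"
    by (simp add: power2_eq_square)
  then have "of_real (pi * exp (A\<^sup>2)) * (- (cis g * of_real C * of_real b) * cnj ?\<beta>) + cnj ?a
      = of_real (A - (pi * exp (A\<^sup>2) * C\<^sup>2) * b) * cnj (cis t)"
    unfolding cc by (auto simp: algebra_simps)
  then have Q: "of_real (pi * exp (A\<^sup>2)) * (- (cis g * of_real C * of_real b) * cnj ?\<beta>) + cnj ?a = 0"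
    unfolding n by (simp add: A_def psi_rate_def)
  show ?thesis
    unfolding u_def psi_rotated A_def[symmetric] C_def[symmetric]
    by (rule affine_minimizer) (simp_all only: \<gamma> a M Q)
qed

lemma minimizer_classification:
  assumes "u \<in> bargmann_fock" "mass u = 1" "energy_G (1/2) u \<le> 1"
  shows "\<exists>w \<in> {phi0, phi1} \<union> {psi b | b::real. 0 \<le> b}. \<exists>g t::real. u = phase_rotation g (space_rotation t w)"
proof -
  obtain \<alpha> \<beta> a \<gamma> where
    u: "u = (\<lambda>z. complex_of_real (exp (- (norm z)\<^sup>2 / 2)) * ((\<alpha> + \<beta> * z) * exp (a * z)))"
    and \<gamma>: "\<gamma> = \<alpha> + \<beta> * cnj a"
    and M: "pi * exp ((cmod a)\<^sup>2) * ((cmod \<gamma>)\<^sup>2 + (cmod \<beta>)\<^sup>2) = 1"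
    and Q: "of_real (pi * exp ((cmod a)\<^sup>2)) * (\<gamma> * cnj \<beta>) + cnj a = 0"
    by (rule minimizer_affine[OF assms])
  have polar: "x = of_real (cmod x) * cis (Arg x)" for x
    using rcis_cmod_Arg[of x] by (simp add: rcis_def)
  show ?thesis
  proof (cases "\<beta> = 0")
    case True
    \<comment> \<open>Without a zero the first-moment condition reduces to \<open>cnj a = 0\<close>,
      leaving the centred Gaussian.\<close>
    then have a: "a = 0" using Q by simp
    then have "pi * (cmod \<alpha>)\<^sup>2 = 1" using M \<gamma> True by simp
    then have "(cmod \<alpha>)\<^sup>2 = (1 / sqrt pi)\<^sup>2" by (simp add: power_divide field_simps)
    then have "cmod \<alpha> = 1 / sqrt pi" by (simp add: power2_eq_iff_nonneg)
    then have "\<alpha> = cis (Arg \<alpha>) * of_real (1 / sqrt pi)" using polar[of \<alpha>] by (simp add: mult.commute)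
    then have "u = phase_rotation (Arg \<alpha>) (space_rotation 0 phi0)"
      unfolding phi0_rotated u True a by simp
    then show ?thesis by blast
  next
    case False
    \<comment> \<open>The position of the zero of the affine factor relative to the Gaussian centre
      \<open>cnj a\<close>: its modulus is the shape parameter \<open>b\<close>, its argument
      determines the space rotation.\<close>
    define q where "q = - \<gamma> / \<beta>"
    define b where "b = cmod q"
    \<comment> \<open>The sign is negative because \<open>space_rotation t\<close> turns the zeros
      of a function by the angle \<open>- t\<close>.\<close>
    define t where "t = - Arg q"
    have q: "q = of_real b * cnj (cis t)" using polar[of q] by (simp add: b_def t_def cis_cnj)
    have \<gamma>q: "\<gamma> = - (q * \<beta>)" using False by (simp add: q_def)
    define m where "m = pi * exp ((cmod a)\<^sup>2) * (cmod \<beta>)\<^sup>2"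
    have "m * (1 + b\<^sup>2) = 1"
      using M by (simp add: \<gamma>q norm_mult power_mult_distrib m_def b_def algebra_simps)
    moreover have b1: "1 + b\<^sup>2 > 0" by (simp add: add_pos_nonneg)
    ultimately have m: "m = 1 / (1 + b\<^sup>2)" by (simp add: field_simps)
    define A where "A = psi_rate b"
    define C where "C = psi_scale b"
    have n: "pi * exp (A\<^sup>2) * C\<^sup>2 = 1 / (1 + b\<^sup>2)" "C > 0" unfolding A_def C_def by (rule psi_normalization psi_scale_pos)+
    have "of_real (pi * exp ((cmod a)\<^sup>2)) * (\<gamma> * cnj \<beta>) = - (of_real m * q)"
      by (simp add: \<gamma>q m_def complex_norm_square del: of_real_power)
    \<comment> \<open>So the centre lies on the ray through \<open>q\<close>, and one rotation
      aligns centre and zero with the real axis.\<close>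
    then have "cnj a = of_real m * q" using Q by (simp add: add_eq_0_iff2)
    also have "\<dots> = of_real A * cnj (cis t)" by (simp add: q m A_def psi_rate_def)
    finally have "cnj (cnj a) = cnj (of_real A * cnj (cis t))" by simp
    then have a: "a = of_real A * cis t" by simp
    have ca: "(cmod a)\<^sup>2 = A\<^sup>2" by (simp add: a norm_mult)
    have "(pi * exp (A\<^sup>2)) * (cmod \<beta>)\<^sup>2 = (pi * exp (A\<^sup>2)) * C\<^sup>2"
      using m n(1) unfolding m_def ca by simp
    then have "(cmod \<beta>)\<^sup>2 = C\<^sup>2" by simp
    then have "cmod \<beta> = C" using n(2) by (simp add: power2_eq_iff_nonneg)
    then have "\<beta> = cis (Arg \<beta>) * of_real C" using polar[of \<beta>] by (simp add: mult.commute)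
    \<comment> \<open>The space rotation already multiplies the coefficient of \<open>z\<close> by
      \<open>cis t\<close>, so the phase has to supply only the rest of the argument of
      \<open>\<beta>\<close>.\<close>
    also have "cis (Arg \<beta>) = cis (Arg \<beta> - t) * cis t" by (simp add: cis_mult)
    finally have \<beta>: "\<beta> = cis (Arg \<beta> - t) * of_real C * cis t" by (simp add: mult_ac)
    define g where "g = Arg \<beta> - t"
    have "\<alpha> = \<gamma> - \<beta> * cnj a" by (simp add: \<gamma>)
    also have "\<dots> = - (\<beta> * cnj (cis t) * of_real (b + A))"
      by (simp add: \<gamma>q q a algebra_simps)
    also have "\<beta> * cnj (cis t) = cis g * of_real C * (cis t * cnj (cis t))"
      by (subst \<beta>) (simp add: g_def)
    also have "cis t * cnj (cis t) = 1" by (simp add: cis_cnj cis_mult)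
    finally have \<alpha>: "\<alpha> = - (cis g * of_real C * of_real (b + A))" by simp
    have "u = phase_rotation g (space_rotation t (psi b))"
      unfolding psi_rotated A_def[symmetric] C_def[symmetric]
      unfolding u \<alpha> a by (subst \<beta>) (simp only: g_def)
    moreover have "0 \<le> b" by (simp add: b_def)
    ultimately show ?thesis by blast
  qed
qed

theorem theorem1p5:
  fixes u :: "complex \<Rightarrow> complex"
  shows "global_minimizer (1/2) u \<longleftrightarrow>
    (\<exists>w \<in> {phi0, phi1} \<union> {psi b | b::real. 0 \<le> b}. \<exists>\<gamma> \<theta>::real.
       u = phase_rotation \<gamma> (space_rotation \<theta> w))"
proof
  assume "global_minimizer (1/2) u"
  \<comment> \<open>Comparison with \<open>phi0\<close>, whose energy is 1, turns minimality into
    the bound required by \<open>minimizer_classification\<close>.\<close>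
  then have "u \<in> bargmann_fock" "mass u = 1" "energy_G (1/2) u \<le> energy_G (1/2) (phase_rotation 0 (space_rotation 0 phi0))"
    using phi0_minimizer[of 0 0] by (auto simp: global_minimizer_def)
  then show "\<exists>w \<in> {phi0, phi1} \<union> {psi b | b::real. 0 \<le> b}. \<exists>\<gamma> \<theta>::real. u = phase_rotation \<gamma> (space_rotation \<theta> w)"
    using phi0_minimizer[of 0 0] by (intro minimizer_classification) auto
next
  assume "\<exists>w \<in> {phi0, phi1} \<union> {psi b | b::real. 0 \<le> b}. \<exists>\<gamma> \<theta>::real. u = phase_rotation \<gamma> (space_rotation \<theta> w)"
  then have "u \<in> bargmann_fock \<and> mass u = 1 \<and> energy_G (1/2) u = 1"
    using phi0_minimizer psi_minimizer by (auto simp: phi1_eq_psi)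
  then show "global_minimizer (1/2) u"
    using energy_ge_1 by (simp add: global_minimizer_def)
qed

end
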